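(* The assignment sending (the isomorphism class of) a $\Delta_1$-completion $d$ to (the isomorphism class of) the complete Galois polarity $G_d$ generated by $d$ is a well-defined bijection between isomorphism classes of $\Delta_1$-completions and isomorphism classes of complete Galois polarities. Moreover, for a fixed poset $P$, this restricts to a bijection between isomorphism classes of $\Delta_1$-completions of $P$ (isomorphism as extensions of $P$) and isomorphism classes of complete Galois polarities extending $P$ (isomorphism as Galois polarities extending $P$).
   Context: For a poset $Q$, $q^\uparrow=\{r:r\ge q\}$, $q^\downarrow=\{r:r\le q\}$. An order embedding $e:P\to Q$ is a completion if $Q$ is a complete lattice; it is a meet-extension if $q=\bigwedge e[e^{-1}(q^\uparrow)]$ for all $q$, a join-extension if $q=\bigvee e[e^{-1}(q^\downarrow)]$ for all $q$. A $\Delta_1$-completion of $P$ is a completion $d:P\to D$ such that every element of $D$ is both a join of meets and a meet of joins of elements of $d[P]$. Two order embeddings $f_1:P_1\to Q_1$, $f_2:P_2\to Q_2$ are isomorphic if there are order isomorphisms $g_P:P_1\to P_2$, $g_Q:Q_1\to Q_2$ with $g_Q\circ f_1=f_2\circ g_P$; for $P_1=P_2=P$ they are isomorphic as extensions of $P$ if moreover $g_P=\mathrm{id}_P$. An extension polarity is $(e_X,e_Y,R)$ with $P$ a poset, $e_X:P\to X$, $e_Y:P\to Y$ order embeddings into disjoint posets, $R\subseteq X\times Y$. It is 3-coherent if (variables over $X,Y,P$): (C1) $x_1\le_X x_2$, $x_2\mathrel{R}y$ imply $x_1\mathrel{R}y$; (C2) $y_1\le_Y y_2$, $x\mathrel{R}y_1$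 imply $x\mathrel{R}y_2$; (C3) $e_X(p)\mathrel{R}e_Y(p)$; (C4) $x\mathrel{R}e_Y(p)$, $e_X(p)\mathrel{R}y$ imply $x\mathrel{R}y$; (C5) $x_1\mathrel{R}e_Y(p)$, $e_X(p)\le_X x_2$ imply $x_1\le_X x_2$; (C6) $y_1\le_Y e_Y(p)$, $e_X(p)\mathrel{R}y_2$ imply $y_1\le_Y y_2$; (C7) if $S\subseteq P$, $\bigwedge e_X[S]=x$ in $X$, $x\mathrel{R}y_2$, $y_1\le_Y e_Y(p)$ for all $p\in S$, then $y_1\le_Y y_2$; (C8) if $T\subseteq P$, $\bigvee e_Y[T]=y$ in $Y$, $x_1\mathrel{R}y$, $e_X(q)\le_X x_2$ for all $q\in T$, then $x_1\le_X x_2$. A Galois polarity is a 3-coherent extension polarity with $e_X$ a meet-extension and $e_Y$ a join-extension; it is complete if $e_X,e_Y$ are completions. For a Galois polarity let $\preceq={\le_X}\cup{\le_Y}\cup R\cup\{(y,x)\in Y\times X:\forall p,q\in P\,(e_Y(p)\le_Y y,\ x\le_X e_X(q)\Rightarrow p\le_P q)\}$ (its unique 3-preorder), $X\uplus Y$ the quotient poset (identify $z_1,z_2$ with $z_1\preceq z_2\preceq z_1$), $\iota_X,\iota_Y$ inclusion followed by quotient, $\gamma=\iota_X\circ e_X=\iota_Y\circ e_Y$. Polarity morphism $h=(h_X,h_P,h_Y):G\to G'$ between Galois polarities $G=(e_X,e_Y,R)$ (over $P$) and $G'=(e_{X'},e_{Y'},R')$ (over $P'$): order preserving $h_X:X\to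 X'$, $h_P:P\to P'$, $h_Y:Y\to Y'$ with (M1) $h_X\circ e_X=e_{X'}\circ h_P$, $h_Y\circ e_Y=e_{Y'}\circ h_P$; (M2) $\iota_Y(y)\le\iota_X(x)\Rightarrow\iota_{Y'}(h_Y(y))\le\iota_{X'}(h_X(x))$; (M3) for all $(x',y')\in (X'\times Y')\setminus R'$ there are $x\in X,y\in Y$ with $h_X^{-1}(x'^\uparrow)\subseteq x^\uparrow$, $h_Y^{-1}(y'^\downarrow)\subseteq y^\downarrow$, $h_X(a)\mathrel{R'}y'\Rightarrow a\mathrel{R}y$ for all $a\in X$, $x'\mathrel{R'}h_Y(b)\Rightarrow x\mathrel{R}b$ for all $b\in Y$, and $(x,y)\notin R$. It is a polarity isomorphism if moreover $h_X,h_P,h_Y$ are order isomorphisms and $h_X(x)\mathrel{R'}h_Y(y)\Rightarrow x\mathrel{R}y$; $G,G'$ are then isomorphic, and isomorphic as Galois polarities extending $P$ if $P=P'$ and $h_P=\mathrm{id}_P$. The Galois polarity generated by a $\Delta_1$-completion $d:P\to D$: let $X_D$ and $Y_D$ be disjoint isomorphic copies of $\{\bigwedge d[S]:S\subseteq P\}$ and $\{\bigvee d[T]:T\subseteq P\}$ (with the order from $D$), $e_{X_D},e_{Y_D}$ the corestrictions of $d$ composed with these copies, and $x\mathrel{R_D}y$ iff (the originals satisfy) $x\le y$ in $D$; $G_d=(e_{X_D},e_{Y_D},R_D)$ is a complete Galois polarity. *)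

theory Defs
  imports "HOL-Algebra.Complete_Lattice"
begin

text \<open>
  Posets are \<^locale>\<open>partial_order\<close> structures on an explicit carrier. The values of the order
  relation and of all maps outside the carriers are irrelevant.
\<close>

section \<open>Extensions and completions of posets\<close>

record ('p, 'd) extension =
  ext_dom :: "'p gorder"
  ext_cod :: "'d gorder"
  ext_map :: "'p \<Rightarrow> 'd"

text \<open>
  \<^const>\<open>order_emb\<close> neither requires \<open>e\<close> to map the carrier of \<open>P\<close> into that of \<open>Q\<close> nor the
  equivalences of \<open>P\<close> and \<open>Q\<close> to be equality.
\<close>

definition order_embedding :: "'p gorder \<Rightarrow> 'd gorder \<Rightarrow> ('p \<Rightarrow> 'd) \<Rightarrow> bool" where
  "order_embedding P Q e \<longleftrightarrow>
     partial_order P \<and> partial_order Q \<and> e \<in> carrier P \<rightarrow> carrier Q \<and> order_emb P Q e"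

definition order_iso :: "'p gorder \<Rightarrow> 'd gorder \<Rightarrow> ('p \<Rightarrow> 'd) \<Rightarrow> bool" where
  "order_iso P Q f \<longleftrightarrow> order_embedding P Q f \<and> bij_betw f (carrier P) (carrier Q)"

definition completion :: "'p gorder \<Rightarrow> 'd gorder \<Rightarrow> ('p \<Rightarrow> 'd) \<Rightarrow> bool" where
  "completion P Q e \<longleftrightarrow> order_embedding P Q e \<and> complete_lattice Q"

definition meet_extension :: "'p gorder \<Rightarrow> 'd gorder \<Rightarrow> ('p \<Rightarrow> 'd) \<Rightarrow> bool" where
  "meet_extension P Q e \<longleftrightarrow> order_embedding P Q e \<and>
     (\<forall>q\<in>carrier Q. is_glb Q q (e ` {p \<in> carrier P. q \<sqsubseteq>\<^bsub>Q\<^esub> e p}))"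

definition join_extension :: "'p gorder \<Rightarrow> 'd gorder \<Rightarrow> ('p \<Rightarrow> 'd) \<Rightarrow> bool" where
  "join_extension P Q e \<longleftrightarrow> order_embedding P Q e \<and>
     (\<forall>q\<in>carrier Q. is_lub Q q (e ` {p \<in> carrier P. e p \<sqsubseteq>\<^bsub>Q\<^esub> q}))"

definition base_meets :: "('p, 'd) extension \<Rightarrow> 'd set" where
  "base_meets d = {z. \<exists>S \<subseteq> carrier (ext_dom d). is_glb (ext_cod d) z (ext_map d ` S)}"

definition base_joins :: "('p, 'd) extension \<Rightarrow> 'd set" where
  "base_joins d = {z. \<exists>T \<subseteq> carrier (ext_dom d). is_lub (ext_cod d) z (ext_map d ` T)}"

definition delta1_completion :: "('p, 'd) extension \<Rightarrow> bool" where
  "delta1_completion d \<longleftrightarrow> completion (ext_dom d) (ext_cod d) (ext_map d) \<and>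
     (\<forall>z\<in>carrier (ext_cod d).
        (\<exists>M \<subseteq> base_meets d. is_lub (ext_cod d) z M) \<and>
        (\<exists>J \<subseteq> base_joins d. is_glb (ext_cod d) z J))"

definition extension_iso_via ::
  "('p, 'd) extension \<Rightarrow> ('q, 'e) extension \<Rightarrow> ('p \<Rightarrow> 'q) \<Rightarrow> ('d \<Rightarrow> 'e) \<Rightarrow> bool" where
  "extension_iso_via f1 f2 gP gQ \<longleftrightarrow>
     order_iso (ext_dom f1) (ext_dom f2) gP \<and>
     order_iso (ext_cod f1) (ext_cod f2) gQ \<and>
     (\<forall>p\<in>carrier (ext_dom f1). gQ (ext_map f1 p) = ext_map f2 (gP p))"

definition extension_iso :: "('p, 'd) extension \<Rightarrow> ('q, 'e) extension \<Rightarrow> bool" where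
  "extension_iso f1 f2 \<longleftrightarrow> (\<exists>gP gQ. extension_iso_via f1 f2 gP gQ)"

definition extension_iso_over ::
  "'p gorder \<Rightarrow> ('p, 'd) extension \<Rightarrow> ('p, 'e) extension \<Rightarrow> bool" where
  "extension_iso_over P f1 f2 \<longleftrightarrow>
     ext_dom f1 = P \<and> ext_dom f2 = P \<and> (\<exists>gQ. extension_iso_via f1 f2 id gQ)"


section \<open>Galois polarities\<close>

text \<open>
  \<open>X\<close> and \<open>Y\<close> live on disjoint carriers in one type, so that relations on \<open>X \<union> Y\<close> need no tagging.
\<close>

record ('p, 'z) polarity =
  pol_P :: "'p gorder"
  pol_X :: "'z gorder"
  pol_Y :: "'z gorder"
  pol_eX :: "'p \<Rightarrow> 'z"
  pol_eY :: "'p \<Rightarrow> 'z"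
  pol_R :: "('z \<times> 'z) set"

definition extension_polarity :: "('p, 'z) polarity \<Rightarrow> bool" where
  "extension_polarity G \<longleftrightarrow>
     order_embedding (pol_P G) (pol_X G) (pol_eX G) \<and>
     order_embedding (pol_P G) (pol_Y G) (pol_eY G) \<and>
     carrier (pol_X G) \<inter> carrier (pol_Y G) = {} \<and>
     pol_R G \<subseteq> carrier (pol_X G) \<times> carrier (pol_Y G)"

definition coherent3 :: "('p, 'z) polarity \<Rightarrow> bool" where
  "coherent3 G \<longleftrightarrow>
    (let P = pol_P G; X = pol_X G; Y = pol_Y G; eX = pol_eX G; eY = pol_eY G; R = pol_R G in
     (\<comment> \<open>C1\<close>
      \<forall>x1\<in>carrier X. \<forall>x2\<in>carrier X. \<forall>y\<in>carrier Y.
        x1 \<sqsubseteq>\<^bsub>X\<^esub> x2 \<and> (x2, y) \<in> R \<longrightarrow> (x1, y) \<in> R) \<and>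
     (\<comment> \<open>C2\<close>
      \<forall>x\<in>carrier X. \<forall>y1\<in>carrier Y. \<forall>y2\<in>carrier Y.
        y1 \<sqsubseteq>\<^bsub>Y\<^esub> y2 \<and> (x, y1) \<in> R \<longrightarrow> (x, y2) \<in> R) \<and>
     (\<comment> \<open>C3\<close>
      \<forall>p\<in>carrier P. (eX p, eY p) \<in> R) \<and>
     (\<comment> \<open>C4\<close>
      \<forall>x\<in>carrier X. \<forall>y\<in>carrier Y. \<forall>p\<in>carrier P.
        (x, eY p) \<in> R \<and> (eX p, y) \<in> R \<longrightarrow> (x, y) \<in> R) \<and>
     (\<comment> \<open>C5\<close>
      \<forall>x1\<in>carrier X. \<forall>x2\<in>carrier X. \<forall>p\<in>carrier P.
        (x1, eY p) \<in> R \<and> eX p \<sqsubseteq>\<^bsub>X\<^esub> x2 \<longrightarrow> x1 \<sqsubseteq>\<^bsub>X\<^esub> x2) \<and>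
     (\<comment> \<open>C6\<close>
      \<forall>y1\<in>carrier Y. \<forall>y2\<in>carrier Y. \<forall>p\<in>carrier P.
        y1 \<sqsubseteq>\<^bsub>Y\<^esub> eY p \<and> (eX p, y2) \<in> R \<longrightarrow> y1 \<sqsubseteq>\<^bsub>Y\<^esub> y2) \<and>
     (\<comment> \<open>C7\<close>
      \<forall>S \<subseteq> carrier P. \<forall>x\<in>carrier X. \<forall>y1\<in>carrier Y. \<forall>y2\<in>carrier Y.
        is_glb X x (eX ` S) \<and> (x, y2) \<in> R \<and> (\<forall>p\<in>S. y1 \<sqsubseteq>\<^bsub>Y\<^esub> eY p) \<longrightarrow> y1 \<sqsubseteq>\<^bsub>Y\<^esub> y2) \<and>
     (\<comment> \<open>C8\<close>
      \<forall>T \<subseteq> carrier P. \<forall>y\<in>carrier Y. \<forall>x1\<in>carrier X. \<forall>x2\<in>carrier X.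
        is_lub Y y (eY ` T) \<and> (x1, y) \<in> R \<and> (\<forall>q\<in>T. eX q \<sqsubseteq>\<^bsub>X\<^esub> x2) \<longrightarrow> x1 \<sqsubseteq>\<^bsub>X\<^esub> x2))"

definition galois_polarity :: "('p, 'z) polarity \<Rightarrow> bool" where
  "galois_polarity G \<longleftrightarrow> extension_polarity G \<and> coherent3 G \<and>
     meet_extension (pol_P G) (pol_X G) (pol_eX G) \<and>
     join_extension (pol_P G) (pol_Y G) (pol_eY G)"

definition complete_galois_polarity :: "('p, 'z) polarity \<Rightarrow> bool" where
  "complete_galois_polarity G \<longleftrightarrow> galois_polarity G \<and>
     completion (pol_P G) (pol_X G) (pol_eX G) \<and>
     completion (pol_P G) (pol_Y G) (pol_eY G)"

definition pol_preorder :: "('p, 'z) polarity \<Rightarrow> ('z \<times> 'z) set" where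
  "pol_preorder G =
     {(x1, x2). x1 \<in> carrier (pol_X G) \<and> x2 \<in> carrier (pol_X G) \<and> x1 \<sqsubseteq>\<^bsub>pol_X G\<^esub> x2} \<union>
     {(y1, y2). y1 \<in> carrier (pol_Y G) \<and> y2 \<in> carrier (pol_Y G) \<and> y1 \<sqsubseteq>\<^bsub>pol_Y G\<^esub> y2} \<union>
     pol_R G \<union>
     {(y, x). y \<in> carrier (pol_Y G) \<and> x \<in> carrier (pol_X G) \<and>
        (\<forall>p\<in>carrier (pol_P G). \<forall>q\<in>carrier (pol_P G).
           pol_eY G p \<sqsubseteq>\<^bsub>pol_Y G\<^esub> y \<and> x \<sqsubseteq>\<^bsub>pol_X G\<^esub> pol_eX G q \<longrightarrow> p \<sqsubseteq>\<^bsub>pol_P G\<^esub> q)}"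

definition pol_equiv :: "('p, 'z) polarity \<Rightarrow> ('z \<times> 'z) set" where
  "pol_equiv G = pol_preorder G \<inter> (pol_preorder G)\<inverse>"

definition pol_quotient :: "('p, 'z) polarity \<Rightarrow> 'z set gorder" where
  "pol_quotient G =
     \<lparr> carrier = (carrier (pol_X G) \<union> carrier (pol_Y G)) // pol_equiv G,
       eq = (=),
       le = (\<lambda>A B. \<exists>a\<in>A. \<exists>b\<in>B. (a, b) \<in> pol_preorder G) \<rparr>"

text \<open>This is \<open>\<iota>\<^sub>X\<close> on the carrier of \<open>X\<close> and \<open>\<iota>\<^sub>Y\<close> on the carrier of \<open>Y\<close>.\<close>

definition pol_iota :: "('p, 'z) polarity \<Rightarrow> 'z \<Rightarrow> 'z set" where
  "pol_iota G z = pol_equiv G `` {z}"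

definition polarity_morphism ::
  "('p, 'z) polarity \<Rightarrow> ('q, 'w) polarity \<Rightarrow> ('z \<Rightarrow> 'w) \<Rightarrow> ('p \<Rightarrow> 'q) \<Rightarrow> ('z \<Rightarrow> 'w) \<Rightarrow> bool" where
  "polarity_morphism G G' hX hP hY \<longleftrightarrow>
    (let P = pol_P G; X = pol_X G; Y = pol_Y G; P' = pol_P G'; X' = pol_X G'; Y' = pol_Y G' in
     hX \<in> carrier X \<rightarrow> carrier X' \<and> isotone X X' hX \<and>
     hP \<in> carrier P \<rightarrow> carrier P' \<and> isotone P P' hP \<and>
     hY \<in> carrier Y \<rightarrow> carrier Y' \<and> isotone Y Y' hY \<and>
     (\<comment> \<open>M1\<close>
      \<forall>p\<in>carrier P. hX (pol_eX G p) = pol_eX G' (hP p) \<and> hY (pol_eY G p) = pol_eY G' (hP p)) \<and>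
     (\<comment> \<open>M2\<close>
      \<forall>x\<in>carrier X. \<forall>y\<in>carrier Y.
        pol_iota G y \<sqsubseteq>\<^bsub>pol_quotient G\<^esub> pol_iota G x \<longrightarrow>
        pol_iota G' (hY y) \<sqsubseteq>\<^bsub>pol_quotient G'\<^esub> pol_iota G' (hX x)) \<and>
     (\<comment> \<open>M3\<close>
      \<forall>(x', y') \<in> (carrier X' \<times> carrier Y') - pol_R G'. \<exists>x\<in>carrier X. \<exists>y\<in>carrier Y.
        {a \<in> carrier X. x' \<sqsubseteq>\<^bsub>X'\<^esub> hX a} \<subseteq> {a \<in> carrier X. x \<sqsubseteq>\<^bsub>X\<^esub> a} \<and>
        {b \<in> carrier Y. hY b \<sqsubseteq>\<^bsub>Y'\<^esub> y'} \<subseteq> {b \<in> carrier Y. b \<sqsubseteq>\<^bsub>Y\<^esub> y} \<and>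
        (\<forall>a\<in>carrier X. (hX a, y') \<in> pol_R G' \<longrightarrow> (a, y) \<in> pol_R G) \<and>
        (\<forall>b\<in>carrier Y. (x', hY b) \<in> pol_R G' \<longrightarrow> (x, b) \<in> pol_R G) \<and>
        (x, y) \<notin> pol_R G))"

definition polarity_iso_via ::
  "('p, 'z) polarity \<Rightarrow> ('q, 'w) polarity \<Rightarrow> ('z \<Rightarrow> 'w) \<Rightarrow> ('p \<Rightarrow> 'q) \<Rightarrow> ('z \<Rightarrow> 'w) \<Rightarrow> bool" where
  "polarity_iso_via G G' hX hP hY \<longleftrightarrow>
     polarity_morphism G G' hX hP hY \<and>
     order_iso (pol_X G) (pol_X G') hX \<and>
     order_iso (pol_P G) (pol_P G') hP \<and>
     order_iso (pol_Y G) (pol_Y G') hY \<and>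
     (\<forall>x\<in>carrier (pol_X G). \<forall>y\<in>carrier (pol_Y G).
        (hX x, hY y) \<in> pol_R G' \<longrightarrow> (x, y) \<in> pol_R G)"

definition polarity_iso :: "('p, 'z) polarity \<Rightarrow> ('q, 'w) polarity \<Rightarrow> bool" where
  "polarity_iso G G' \<longleftrightarrow> (\<exists>hX hP hY. polarity_iso_via G G' hX hP hY)"

definition polarity_iso_over ::
  "'p gorder \<Rightarrow> ('p, 'z) polarity \<Rightarrow> ('p, 'w) polarity \<Rightarrow> bool" where
  "polarity_iso_over P G G' \<longleftrightarrow>
     pol_P G = P \<and> pol_P G' = P \<and> (\<exists>hX hY. polarity_iso_via G G' hX id hY)"


section \<open>The polarity generated by an extension\<close>

definition generated_polarity :: "('p, 'd) extension \<Rightarrow> ('p, 'd + 'd) polarity" where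
  "generated_polarity d =
     \<lparr> pol_P = ext_dom d,
       pol_X = \<lparr> carrier = Inl ` base_meets d, eq = (=),
                 le = (\<lambda>u v. projl u \<sqsubseteq>\<^bsub>ext_cod d\<^esub> projl v) \<rparr>,
       pol_Y = \<lparr> carrier = Inr ` base_joins d, eq = (=),
                 le = (\<lambda>u v. projr u \<sqsubseteq>\<^bsub>ext_cod d\<^esub> projr v) \<rparr>,
       pol_eX = (\<lambda>p. Inl (ext_map d p)),
       pol_eY = (\<lambda>p. Inr (ext_map d p)),
       pol_R = {(Inl x, Inr y) | x y.
                  x \<in> base_meets d \<and> y \<in> base_joins d \<and> x \<sqsubseteq>\<^bsub>ext_cod d\<^esub> y} \<rparr>"


section \<open>Isomorphism classes\<close>

text \<open>
  The isomorphism classes are the equivalence classes of the following relations. To form the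
  sets of all classes one has to fix carrier types. If \<open>P\<close> has a carrier in \<^typ>\<open>'p\<close>,
  then every \<open>\<Delta>\<^sub>1\<close>-completion of \<open>P\<close> is isomorphic, as an extension of \<open>P\<close>, to one with a carrier
  in \<^typ>\<open>'p set set\<close> (send \<open>z\<close> to the set of all \<open>S \<subseteq> P\<close> whose meet is below \<open>z\<close>), and every
  complete Galois polarity extending \<open>P\<close> is isomorphic to one with carriers in
  \<^typ>\<open>'p set set + 'p set set\<close>. Hence these types represent all classes over \<^typ>\<open>'p\<close>.
\<close>

definition delta1_iso_rel :: "(('p, 'd) extension \<times> ('p, 'd) extension) set" where
  "delta1_iso_rel =
     {(d1, d2). delta1_completion d1 \<and> delta1_completion d2 \<and> extension_iso d1 d2}"

definition delta1_iso_rel_over ::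
  "'p gorder \<Rightarrow> (('p, 'd) extension \<times> ('p, 'd) extension) set" where
  "delta1_iso_rel_over P =
     {(d1, d2). delta1_completion d1 \<and> delta1_completion d2 \<and> extension_iso_over P d1 d2}"

definition polarity_iso_rel :: "(('p, 'z) polarity \<times> ('p, 'z) polarity) set" where
  "polarity_iso_rel =
     {(G1, G2). complete_galois_polarity G1 \<and> complete_galois_polarity G2 \<and> polarity_iso G1 G2}"

definition polarity_iso_rel_over ::
  "'p gorder \<Rightarrow> (('p, 'z) polarity \<times> ('p, 'z) polarity) set" where
  "polarity_iso_rel_over P =
     {(G1, G2). complete_galois_polarity G1 \<and> complete_galois_polarity G2 \<and>
        polarity_iso_over P G1 G2}"

end

theory Submission
  imports Defs
begin

text \<open>
  A \<open>\<Delta>\<^sub>1\<close>-completion is determined up to isomorphism by the relation \<open>x \<le> y\<close> between its base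
  meets \<open>x\<close> and its base joins \<open>y\<close>, since the former are join-dense and the latter meet-dense.
  Conversely, a complete Galois polarity \<open>(e\<^sub>X, e\<^sub>Y, R)\<close> is recovered from the concept lattice of \<open>R\<close>:
  completeness of \<open>X\<close> and \<open>Y\<close> makes the images of \<open>X\<close> and \<open>Y\<close> in that lattice exactly the base
  meets and base joins.
\<close>

section \<open>Posets on explicit carriers\<close>

text \<open>Polarity isomorphisms are defined through (M2) and (M3), and neither says outright that
  \<open>R\<close> is preserved. The proof therefore works with \<open>polarity_strict_iso\<close>,
  where \<open>R\<close> is preserved and reflected; in this form isomorphisms compose and invert
  directly, and between Galois polarities they are the original ones. Completeness gives exactly the
  base meets for this reason: the embedding of X into the concept lattice preserves meets of images
  of P. Once every such family has a meet in X, each base meet is the image of a point of X; the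
  other inclusion is the meet-extension property. The claim for Y and the base joins has the same
  shape, but joins of concepts need not be unions, so it is proved through meet-density. Every
  passage between completions and polarities keeps the map on P unchanged. Choosing it to be
  \<open>id\<close> gives the statement over a fixed P from the same lemmas, and the bijections on
  classes are then formal.\<close>

lemma partial_order_le_refl: "partial_order L \<Longrightarrow> x \<in> carrier L \<Longrightarrow> x \<sqsubseteq>\<^bsub>L\<^esub> x"
  by (simp add: partial_order.axioms(1) weak_partial_order.le_refl)

lemma partial_order_le_trans:
  "partial_order L \<Longrightarrow> x \<sqsubseteq>\<^bsub>L\<^esub> y \<Longrightarrow> y \<sqsubseteq>\<^bsub>L\<^esub> z \<Longrightarrow> x \<in> carrier L \<Longrightarrow> y \<in> carrier L \<Longrightarrow> z \<in> carrier L \<Longrightarrow>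
    x \<sqsubseteq>\<^bsub>L\<^esub> z"
  by (meson partial_order.axioms(1) weak_partial_order.le_trans)

lemma partial_order_le_antisym:
  "partial_order L \<Longrightarrow> x \<sqsubseteq>\<^bsub>L\<^esub> y \<Longrightarrow> y \<sqsubseteq>\<^bsub>L\<^esub> x \<Longrightarrow> x \<in> carrier L \<Longrightarrow> y \<in> carrier L \<Longrightarrow> x = y"
  by (rule partial_order.le_antisym)

lemma partial_orderI:
  assumes "eq L = (=)"
    and "\<And>x. x \<in> carrier L \<Longrightarrow> x \<sqsubseteq>\<^bsub>L\<^esub> x"
    and "\<And>x y. x \<sqsubseteq>\<^bsub>L\<^esub> y \<Longrightarrow> y \<sqsubseteq>\<^bsub>L\<^esub> x \<Longrightarrow> x \<in> carrier L \<Longrightarrow> y \<in> carrier L \<Longrightarrow> x = y"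
    and "\<And>x y z. x \<sqsubseteq>\<^bsub>L\<^esub> y \<Longrightarrow> y \<sqsubseteq>\<^bsub>L\<^esub> z \<Longrightarrow>
      x \<in> carrier L \<Longrightarrow> y \<in> carrier L \<Longrightarrow> z \<in> carrier L \<Longrightarrow> x \<sqsubseteq>\<^bsub>L\<^esub> z"
  shows "partial_order L"
proof -
  interpret equivalence L
    by (unfold_locales) (simp_all add: assms(1))
  show ?thesis
  proof (unfold_locales, goal_cases)
    case 3
    show ?case by (rule assms(4)[OF 3])
  qed (use assms(1-3) in auto)
qed

text \<open>A single equivalence for both halves of being a greatest lower bound lets later proofs
  argue by rewriting; the lower-bound half is recovered at \<open>l = x\<close> by
  reflexivity.\<close>

lemma is_glb_iff:
  assumes "partial_order L" "A \<subseteq> carrier L"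
  shows "is_glb L x A \<longleftrightarrow> x \<in> carrier L \<and> (\<forall>l\<in>carrier L. l \<sqsubseteq>\<^bsub>L\<^esub> x \<longleftrightarrow> (\<forall>a\<in>A. l \<sqsubseteq>\<^bsub>L\<^esub> a))"
proof
  assume glb: "is_glb L x A"
  then have x: "x \<in> carrier L" "\<And>a. a \<in> A \<Longrightarrow> x \<sqsubseteq>\<^bsub>L\<^esub> a"
    using assms(2) by (auto simp: greatest_def Lower_def)
  have "l \<sqsubseteq>\<^bsub>L\<^esub> x \<longleftrightarrow> (\<forall>a\<in>A. l \<sqsubseteq>\<^bsub>L\<^esub> a)" if "l \<in> carrier L" for l
  proof
    show "\<forall>a\<in>A. l \<sqsubseteq>\<^bsub>L\<^esub> a" if "l \<sqsubseteq>\<^bsub>L\<^esub> x"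
      using partial_order_le_trans[OF assms(1) that] x \<open>l \<in> carrier L\<close> assms(2) by auto
    show "l \<sqsubseteq>\<^bsub>L\<^esub> x" if "\<forall>a\<in>A. l \<sqsubseteq>\<^bsub>L\<^esub> a"
      using glb that \<open>l \<in> carrier L\<close> by (auto simp: greatest_def Lower_def)
  qed
  with x show "x \<in> carrier L \<and> (\<forall>l\<in>carrier L. l \<sqsubseteq>\<^bsub>L\<^esub> x \<longleftrightarrow> (\<forall>a\<in>A. l \<sqsubseteq>\<^bsub>L\<^esub> a))"
    by blast
next
  assume "x \<in> carrier L \<and> (\<forall>l\<in>carrier L. l \<sqsubseteq>\<^bsub>L\<^esub> x \<longleftrightarrow> (\<forall>a\<in>A. l \<sqsubseteq>\<^bsub>L\<^esub> a))"
  then show "is_glb L x A"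
    using assms(2) partial_order_le_refl[OF assms(1)]
    unfolding greatest_def Lower_def by auto
qed

section \<open>Duality and completeness\<close>

lemma partial_order_dual: "partial_order L \<Longrightarrow> partial_order (inv_gorder L)"
  by (rule partial_orderI)
    (auto simp: partial_order.eq_is_equal intro: partial_order_le_refl partial_order_le_trans
      partial_order_le_antisym)

lemma is_lub_iff:
  assumes "partial_order L" "A \<subseteq> carrier L"
  shows "is_lub L x A \<longleftrightarrow> x \<in> carrier L \<and> (\<forall>u\<in>carrier L. x \<sqsubseteq>\<^bsub>L\<^esub> u \<longleftrightarrow> (\<forall>a\<in>A. a \<sqsubseteq>\<^bsub>L\<^esub> u))"
  using is_glb_iff[OF partial_order_dual[OF assms(1)], of A x] assms(2) by simp

text \<open>The criterion asks for a top element and for meets of nonempty sets; the meet of the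
  empty set is the top.\<close>

lemma complete_lattice_if_glbs:
  assumes "partial_order L" "\<And>A. A \<subseteq> carrier L \<Longrightarrow> \<exists>x. is_glb L x A"
  shows "complete_lattice L"
  using partial_order.complete_lattice_criterion1[OF assms(1)] assms(2)[of "{}"] assms(2) by auto

lemma complete_lattice_if_lubs:
  assumes "partial_order L" "\<And>A. A \<subseteq> carrier L \<Longrightarrow> \<exists>x. is_lub L x A"
  shows "complete_lattice L"
proof -
  interpret dual: complete_lattice "inv_gorder L"
    using complete_lattice_if_glbs[OF partial_order_dual[OF assms(1)]] assms(2) by simp
  show ?thesis
    using dual.sup_exists partial_order.complete_latticeI[OF assms(1)] assms(2) by simp
qed

lemma complete_lattice_dual: "complete_lattice L \<Longrightarrow> complete_lattice (inv_gorder L)"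
  by (rule complete_lattice_if_glbs)
    (auto intro: partial_order_dual complete_lattice.axioms(1) complete_lattice.sup_exists)

lemma complete_lattice_glb_exists:
  "complete_lattice L \<Longrightarrow> A \<subseteq> carrier L \<Longrightarrow> \<exists>x. is_glb L x A"
  by (rule complete_lattice.inf_exists)

lemma complete_lattice_lub_exists:
  "complete_lattice L \<Longrightarrow> A \<subseteq> carrier L \<Longrightarrow> \<exists>x. is_lub L x A"
  by (rule complete_lattice.sup_exists)

text \<open>Shaped for the two orders of \<open>generated_polarity\<close>, where \<open>f\<close>
  is \<open>projl\<close> or \<open>projr\<close>. Injectivity is what makes antisymmetry hold up to
  equality.\<close>

lemma partial_order_pullback:
  assumes "partial_order L" "f \<in> A \<rightarrow> carrier L" "inj_on f A"
  shows "partial_order \<lparr>carrier = A, eq = (=), le = (\<lambda>u v. f u \<sqsubseteq>\<^bsub>L\<^esub> f v)\<rparr>"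
proof (rule partial_orderI, goal_cases)
  case (3 x y)
  then show ?case
    using assms partial_order_le_antisym[OF assms(1), of "f x" "f y"]
    by (auto simp: Pi_iff inj_on_def)
next
  case (4 x y z)
  then show ?case
    using assms partial_order_le_trans[OF assms(1), of "f x" "f y" "f z"] by (auto simp: Pi_iff)
qed (use assms partial_order_le_refl[OF assms(1)] in \<open>auto simp: Pi_iff\<close>)

lemma order_embedding_iff:
  "order_embedding P Q e \<longleftrightarrow> partial_order P \<and> partial_order Q \<and> e \<in> carrier P \<rightarrow> carrier Q \<and>
     (\<forall>x\<in>carrier P. \<forall>y\<in>carrier P. e x \<sqsubseteq>\<^bsub>Q\<^esub> e y \<longleftrightarrow> x \<sqsubseteq>\<^bsub>P\<^esub> y)"
  by (auto simp: order_embedding_def order_emb_def partial_order.axioms(1))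

lemma order_iso_id: "partial_order P \<Longrightarrow> order_iso P P id"
  by (auto simp: order_iso_def order_embedding_iff)

lemma order_iso_compose:
  "order_iso P Q f \<Longrightarrow> order_iso Q R g \<Longrightarrow> order_iso P R (g \<circ> f)"
  unfolding order_iso_def order_embedding_iff
  by (auto simp: Pi_iff intro: bij_betw_trans)

lemma order_iso_inverse:
  assumes f: "order_iso P Q f" and g: "\<And>x. x \<in> carrier P \<Longrightarrow> g (f x) = x"
  shows "order_iso Q P g"
proof -
  have bij: "bij_betw f (carrier P) (carrier Q)"
    using f by (simp add: order_iso_def)
  have "g ` carrier Q = carrier P" "inj_on g (carrier Q)"
    using bij_betw_imp_surj_on[OF bij, symmetric] g by (auto simp: image_image intro!: inj_onI)
  moreover have "g x \<sqsubseteq>\<^bsub>P\<^esub> g y \<longleftrightarrow> x \<sqsubseteq>\<^bsub>Q\<^esub> y" if "x \<in> carrier Q" "y \<in> carrier Q" for x y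
    using f that g bij_betw_imp_surj_on[OF bij, symmetric]
    by (auto simp: order_iso_def order_embedding_iff)
  ultimately show ?thesis
    using f by (auto simp: order_iso_def order_embedding_iff bij_betw_def)
qed

text \<open>Order reflection and antisymmetry force injectivity, so only surjectivity and the
  comparison of values remain to be checked.\<close>

lemma order_isoI:
  assumes "partial_order P" "partial_order Q" "f ` carrier P = carrier Q"
    and "\<And>x y. x \<in> carrier P \<Longrightarrow> y \<in> carrier P \<Longrightarrow> f x \<sqsubseteq>\<^bsub>Q\<^esub> f y \<longleftrightarrow> x \<sqsubseteq>\<^bsub>P\<^esub> y"
  shows "order_iso P Q f"
proof -
  have "inj_on f (carrier P)"
  proof (rule inj_onI)
    fix x y assume *: "x \<in> carrier P" "y \<in> carrier P" "f x = f y"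
    then have "f x \<sqsubseteq>\<^bsub>Q\<^esub> f y" "f y \<sqsubseteq>\<^bsub>Q\<^esub> f x"
      using assms(3) partial_order_le_refl[OF assms(2)] by auto
    with * show "x = y"
      using assms(4) partial_order_le_antisym[OF assms(1)] by blast
  qed
  then show ?thesis
    using assms by (auto simp: order_iso_def order_embedding_iff bij_betw_def)
qed

section \<open>Isomorphisms of Galois polarities\<close>

text \<open>Replaces (M2) and (M3) by preservation and reflection of \<open>R\<close>, so that no
  quotient and no existential witness appears. \<open>polarity_iso_via_iff\<close> shows that
  nothing changes for Galois polarities.\<close>

definition polarity_strict_iso ::
  "('p, 'z) polarity \<Rightarrow> ('q, 'w) polarity \<Rightarrow> ('z \<Rightarrow> 'w) \<Rightarrow> ('p \<Rightarrow> 'q) \<Rightarrow> ('z \<Rightarrow> 'w) \<Rightarrow> bool" where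
  "polarity_strict_iso G G' hX hP hY \<longleftrightarrow>
     order_iso (pol_X G) (pol_X G') hX \<and>
     order_iso (pol_P G) (pol_P G') hP \<and>
     order_iso (pol_Y G) (pol_Y G') hY \<and>
     (\<forall>p\<in>carrier (pol_P G).
        hX (pol_eX G p) = pol_eX G' (hP p) \<and> hY (pol_eY G p) = pol_eY G' (hP p)) \<and>
     (\<forall>x\<in>carrier (pol_X G). \<forall>y\<in>carrier (pol_Y G).
        (hX x, hY y) \<in> pol_R G' \<longleftrightarrow> (x, y) \<in> pol_R G)"

lemma order_iso_pre_image:
  assumes "order_iso P Q f" "y \<in> carrier Q"
  obtains x where "x \<in> carrier P" "y = f x"
  using assms by (metis bij_betw_imp_surj_on imageE order_iso_def)

text \<open>The preorder is built from the three orders, \<open>R\<close> and the two embeddings,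
  all of which a strict isomorphism respects. In the part from Y to X, surjectivity of
  \<open>hP\<close> lets the quantifiers over P' be read as quantifiers over P. Since the carriers
  of X and Y are disjoint, \<open>hX\<close> and \<open>hY\<close> glue to one map
  \<open>h\<close>.\<close>

lemma strict_iso_preorder:
  assumes ext: "extension_polarity G" and iso: "polarity_strict_iso G G' hX hP hY"
    and ab: "(a, b) \<in> pol_preorder G"
  defines "h \<equiv> \<lambda>z. if z \<in> carrier (pol_X G) then hX z else hY z"
  shows "(h a, h b) \<in> pol_preorder G'"
proof -
  have hX: "h x = hX x" "hX x \<in> carrier (pol_X G')" if "x \<in> carrier (pol_X G)" for x
    using that iso
    by (auto simp: h_def polarity_strict_iso_def order_iso_def order_embedding_iff Pi_iff)
  have hY: "h y = hY y" "hY y \<in> carrier (pol_Y G')" if "y \<in> carrier (pol_Y G)" for y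
    using that iso ext
    by (auto simp: h_def polarity_strict_iso_def order_iso_def order_embedding_iff Pi_iff
        extension_polarity_def)
  have leX: "hX x \<sqsubseteq>\<^bsub>pol_X G'\<^esub> hX x' \<longleftrightarrow> x \<sqsubseteq>\<^bsub>pol_X G\<^esub> x'"
    if "x \<in> carrier (pol_X G)" "x' \<in> carrier (pol_X G)" for x x'
    using that iso by (auto simp: polarity_strict_iso_def order_iso_def order_embedding_iff)
  have leY: "hY x \<sqsubseteq>\<^bsub>pol_Y G'\<^esub> hY x' \<longleftrightarrow> x \<sqsubseteq>\<^bsub>pol_Y G\<^esub> x'"
    if "x \<in> carrier (pol_Y G)" "x' \<in> carrier (pol_Y G)" for x x'
    using that iso by (auto simp: polarity_strict_iso_def order_iso_def order_embedding_iff)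
  have leP: "hP x \<sqsubseteq>\<^bsub>pol_P G'\<^esub> hP x' \<longleftrightarrow> x \<sqsubseteq>\<^bsub>pol_P G\<^esub> x'"
    if "x \<in> carrier (pol_P G)" "x' \<in> carrier (pol_P G)" for x x'
    using that iso by (auto simp: polarity_strict_iso_def order_iso_def order_embedding_iff)
  have e: "pol_eX G p \<in> carrier (pol_X G)" "pol_eY G p \<in> carrier (pol_Y G)"
    if "p \<in> carrier (pol_P G)" for p
    using that ext by (auto simp: extension_polarity_def order_embedding_iff Pi_iff)
  have commute: "pol_eX G' (hP p) = hX (pol_eX G p)" "pol_eY G' (hP p) = hY (pol_eY G p)"
    if "p \<in> carrier (pol_P G)" for p
    using that iso by (auto simp: polarity_strict_iso_def)
  from ab consider
      "a \<in> carrier (pol_X G)" "b \<in> carrier (pol_X G)" "a \<sqsubseteq>\<^bsub>pol_X G\<^esub> b"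
    | "a \<in> carrier (pol_Y G)" "b \<in> carrier (pol_Y G)" "a \<sqsubseteq>\<^bsub>pol_Y G\<^esub> b"
    | "(a, b) \<in> pol_R G"
    | "a \<in> carrier (pol_Y G)" "b \<in> carrier (pol_X G)"
      "\<And>p q. p \<in> carrier (pol_P G) \<Longrightarrow> q \<in> carrier (pol_P G) \<Longrightarrow>
        pol_eY G p \<sqsubseteq>\<^bsub>pol_Y G\<^esub> a \<Longrightarrow> b \<sqsubseteq>\<^bsub>pol_X G\<^esub> pol_eX G q \<Longrightarrow> p \<sqsubseteq>\<^bsub>pol_P G\<^esub> q"
    by (auto simp: pol_preorder_def)
  then show ?thesis
  proof cases
    case 1
    then show ?thesis by (simp add: pol_preorder_def hX leX)
  next
    case 2
    then show ?thesis by (simp add: pol_preorder_def hY leY)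
  next
    case 3
    then have "a \<in> carrier (pol_X G)" "b \<in> carrier (pol_Y G)"
      using ext by (auto simp: extension_polarity_def)
    with 3 iso show ?thesis
      by (simp add: pol_preorder_def hX hY polarity_strict_iso_def)
  next
    case 4
    have "p' \<sqsubseteq>\<^bsub>pol_P G'\<^esub> q'"
      if asm: "p' \<in> carrier (pol_P G')" "q' \<in> carrier (pol_P G')"
        "pol_eY G' p' \<sqsubseteq>\<^bsub>pol_Y G'\<^esub> hY a" "hX b \<sqsubseteq>\<^bsub>pol_X G'\<^esub> pol_eX G' q'" for p' q'
    proof -
      have hP: "order_iso (pol_P G) (pol_P G') hP"
        using iso by (simp add: polarity_strict_iso_def)
      obtain p where p: "p \<in> carrier (pol_P G)" "p' = hP p"
        by (rule order_iso_pre_image[OF hP asm(1)])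
      obtain q where q: "q \<in> carrier (pol_P G)" "q' = hP q"
        by (rule order_iso_pre_image[OF hP asm(2)])
      show ?thesis
        using asm p q 4 by (simp add: commute leX leY leP e)
    qed
    with 4 show ?thesis
      by (simp add: pol_preorder_def hX hY)
  qed
qed

text \<open>(M2) follows because the preorder determines the quotient and is carried over. For (M3)
  the witnesses are the preimages of \<open>x'\<close> and \<open>y'\<close>, which turn each clause
  into an instance of preservation or reflection.\<close>

lemma strict_iso_imp_iso_via:
  assumes ext: "extension_polarity G" and iso: "polarity_strict_iso G G' hX hP hY"
  shows "polarity_iso_via G G' hX hP hY"
proof -
  have isos: "order_iso (pol_X G) (pol_X G') hX" "order_iso (pol_P G) (pol_P G') hP"
    "order_iso (pol_Y G) (pol_Y G') hY"
    and R: "\<And>x y. x \<in> carrier (pol_X G) \<Longrightarrow> y \<in> carrier (pol_Y G) \<Longrightarrow>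
      (hX x, hY y) \<in> pol_R G' \<longleftrightarrow> (x, y) \<in> pol_R G"
    using iso by (auto simp: polarity_strict_iso_def)
  define h where "h = (\<lambda>z. if z \<in> carrier (pol_X G) then hX z else hY z)"
  have hX: "h x = hX x" if "x \<in> carrier (pol_X G)" for x
    using that by (simp add: h_def)
  have hY: "h y = hY y" if "y \<in> carrier (pol_Y G)" for y
    using that ext by (auto simp: h_def extension_polarity_def)
  have pre: "(h a, h b) \<in> pol_preorder G'" if "(a, b) \<in> pol_preorder G" for a b
    using strict_iso_preorder[OF ext iso that] by (simp add: h_def)
  have M2: "pol_iota G' (hY y) \<sqsubseteq>\<^bsub>pol_quotient G'\<^esub> pol_iota G' (hX x)"
    if asm: "x \<in> carrier (pol_X G)" "y \<in> carrier (pol_Y G)"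
      "pol_iota G y \<sqsubseteq>\<^bsub>pol_quotient G\<^esub> pol_iota G x" for x y
  proof -
    \<comment> \<open>Classes are compared through some pair of representatives; \<open>h\<close>
      carries the pair found for \<open>G\<close>, with its links to \<open>y\<close> and
      \<open>x\<close>, over to \<open>G'\<close>.\<close>
    obtain a b where ab: "(y, a) \<in> pol_equiv G" "(x, b) \<in> pol_equiv G" "(a, b) \<in> pol_preorder G"
      using asm(3) by (auto simp: pol_quotient_def pol_iota_def)
    then have "(h y, h a) \<in> pol_equiv G'" "(h x, h b) \<in> pol_equiv G'" "(h a, h b) \<in> pol_preorder G'"
      using pre by (auto simp: pol_equiv_def)
    then show ?thesis
      using asm by (auto simp: pol_quotient_def pol_iota_def hX hY)
  qed
  have M3: "\<forall>(x', y') \<in> (carrier (pol_X G') \<times> carrier (pol_Y G')) - pol_R G'.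
      \<exists>x\<in>carrier (pol_X G). \<exists>y\<in>carrier (pol_Y G).
        {a \<in> carrier (pol_X G). x' \<sqsubseteq>\<^bsub>pol_X G'\<^esub> hX a} \<subseteq> {a \<in> carrier (pol_X G). x \<sqsubseteq>\<^bsub>pol_X G\<^esub> a} \<and>
        {b \<in> carrier (pol_Y G). hY b \<sqsubseteq>\<^bsub>pol_Y G'\<^esub> y'} \<subseteq> {b \<in> carrier (pol_Y G). b \<sqsubseteq>\<^bsub>pol_Y G\<^esub> y} \<and>
        (\<forall>a\<in>carrier (pol_X G). (hX a, y') \<in> pol_R G' \<longrightarrow> (a, y) \<in> pol_R G) \<and>
        (\<forall>b\<in>carrier (pol_Y G). (x', hY b) \<in> pol_R G' \<longrightarrow> (x, b) \<in> pol_R G) \<and>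
        (x, y) \<notin> pol_R G"
  proof (rule ballI, rule case_prodI2)
    fix z x' y' assume "z \<in> (carrier (pol_X G') \<times> carrier (pol_Y G')) - pol_R G'" "z = (x', y')"
    then have asm: "x' \<in> carrier (pol_X G')" "y' \<in> carrier (pol_Y G')" "(x', y') \<notin> pol_R G'"
      by auto
    obtain x where x: "x \<in> carrier (pol_X G)" "x' = hX x"
      by (rule order_iso_pre_image[OF isos(1) asm(1)])
    obtain y where y: "y \<in> carrier (pol_Y G)" "y' = hY y"
      by (rule order_iso_pre_image[OF isos(3) asm(2)])
    show "\<exists>x\<in>carrier (pol_X G). \<exists>y\<in>carrier (pol_Y G).
        {a \<in> carrier (pol_X G). x' \<sqsubseteq>\<^bsub>pol_X G'\<^esub> hX a} \<subseteq> {a \<in> carrier (pol_X G). x \<sqsubseteq>\<^bsub>pol_X G\<^esub> a} \<and>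
        {b \<in> carrier (pol_Y G). hY b \<sqsubseteq>\<^bsub>pol_Y G'\<^esub> y'} \<subseteq> {b \<in> carrier (pol_Y G). b \<sqsubseteq>\<^bsub>pol_Y G\<^esub> y} \<and>
        (\<forall>a\<in>carrier (pol_X G). (hX a, y') \<in> pol_R G' \<longrightarrow> (a, y) \<in> pol_R G) \<and>
        (\<forall>b\<in>carrier (pol_Y G). (x', hY b) \<in> pol_R G' \<longrightarrow> (x, b) \<in> pol_R G) \<and>
        (x, y) \<notin> pol_R G"
      using asm x y R isos
      by (intro bexI[OF _ x(1)] bexI[OF _ y(1)]) (auto simp: order_iso_def order_embedding_iff)
  qed
  have "hX \<in> carrier (pol_X G) \<rightarrow> carrier (pol_X G')" "isotone (pol_X G) (pol_X G') hX"
    "hP \<in> carrier (pol_P G) \<rightarrow> carrier (pol_P G')" "isotone (pol_P G) (pol_P G') hP"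
    "hY \<in> carrier (pol_Y G) \<rightarrow> carrier (pol_Y G')" "isotone (pol_Y G) (pol_Y G') hY"
    using isos by (auto simp: order_iso_def order_embedding_def order_emb_isotone)
  moreover have "\<forall>p\<in>carrier (pol_P G).
      hX (pol_eX G p) = pol_eX G' (hP p) \<and> hY (pol_eY G p) = pol_eY G' (hP p)"
    using iso by (simp add: polarity_strict_iso_def)
  ultimately have "polarity_morphism G G' hX hP hY"
    unfolding polarity_morphism_def Let_def
    by (intro conjI M3 ballI impI M2) simp_all
  then show ?thesis
    using isos R by (auto simp: polarity_iso_via_def)
qed

section \<open>Single coherence conditions\<close>

lemma coherent3_C1:
  assumes "coherent3 G" "x1 \<in> carrier (pol_X G)" "x2 \<in> carrier (pol_X G)" "y \<in> carrier (pol_Y G)"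
    "x1 \<sqsubseteq>\<^bsub>pol_X G\<^esub> x2" "(x2, y) \<in> pol_R G"
  shows "(x1, y) \<in> pol_R G"
  using assms(1)[unfolded coherent3_def Let_def, THEN conjunct1] assms(2-) by blast

lemma coherent3_C2:
  assumes "coherent3 G" "x \<in> carrier (pol_X G)" "y1 \<in> carrier (pol_Y G)" "y2 \<in> carrier (pol_Y G)"
    "y1 \<sqsubseteq>\<^bsub>pol_Y G\<^esub> y2" "(x, y1) \<in> pol_R G"
  shows "(x, y2) \<in> pol_R G"
  using assms(1)[unfolded coherent3_def Let_def, THEN conjunct2, THEN conjunct1] assms(2-) by blast

lemma coherent3_C3:
  assumes "coherent3 G" "p \<in> carrier (pol_P G)"
  shows "(pol_eX G p, pol_eY G p) \<in> pol_R G"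
  using assms(1)[unfolded coherent3_def Let_def, THEN conjunct2, THEN conjunct2, THEN conjunct1]
    assms(2-) by blast

lemma coherent3_C5:
  assumes "coherent3 G" "x1 \<in> carrier (pol_X G)" "x2 \<in> carrier (pol_X G)" "p \<in> carrier (pol_P G)"
    "(x1, pol_eY G p) \<in> pol_R G" "pol_eX G p \<sqsubseteq>\<^bsub>pol_X G\<^esub> x2"
  shows "x1 \<sqsubseteq>\<^bsub>pol_X G\<^esub> x2"
  using assms(1)[unfolded coherent3_def Let_def, THEN conjunct2, THEN conjunct2, THEN conjunct2,
      THEN conjunct2, THEN conjunct1] assms(2-) by blast

lemma coherent3_C6:
  assumes "coherent3 G" "y1 \<in> carrier (pol_Y G)" "y2 \<in> carrier (pol_Y G)" "p \<in> carrier (pol_P G)"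
    "y1 \<sqsubseteq>\<^bsub>pol_Y G\<^esub> pol_eY G p" "(pol_eX G p, y2) \<in> pol_R G"
  shows "y1 \<sqsubseteq>\<^bsub>pol_Y G\<^esub> y2"
  using assms(1)[unfolded coherent3_def Let_def, THEN conjunct2, THEN conjunct2, THEN conjunct2,
      THEN conjunct2, THEN conjunct2, THEN conjunct1] assms(2-) by blast

text \<open>
  A morphism is not required to preserve \<open>R\<close>; for an isomorphism this follows from (M3), whose
  witnesses for \<open>(hX x, hY y)\<close> lie below \<open>x\<close> and above \<open>y\<close>, together with (C1) and (C2).
\<close>
lemma iso_via_imp_strict_iso:
  assumes G: "galois_polarity G" and via: "polarity_iso_via G G' hX hP hY"
  shows "polarity_strict_iso G G' hX hP hY"
proof -
  have isos: "order_iso (pol_X G) (pol_X G') hX" "order_iso (pol_P G) (pol_P G') hP"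
    "order_iso (pol_Y G) (pol_Y G') hY"
    and mor: "polarity_morphism G G' hX hP hY"
    and R: "\<And>x y. x \<in> carrier (pol_X G) \<Longrightarrow> y \<in> carrier (pol_Y G) \<Longrightarrow>
      (hX x, hY y) \<in> pol_R G' \<Longrightarrow> (x, y) \<in> pol_R G"
    using via unfolding polarity_iso_via_def by blast+
  \<comment> \<open>The six conjuncts skipped here are typing and monotonicity of the three maps;
    (M1), (M2) and (M3) remain.\<close>
  note mor' = mor[unfolded polarity_morphism_def Let_def, THEN conjunct2, THEN conjunct2,
      THEN conjunct2, THEN conjunct2, THEN conjunct2, THEN conjunct2]
  note M1 = mor'[THEN conjunct1] and M3 = mor'[THEN conjunct2, THEN conjunct2]
  have coh: "coherent3 G"
    using G by (simp add: galois_polarity_def)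
  have pres: "(hX x, hY y) \<in> pol_R G'"
    if xy: "x \<in> carrier (pol_X G)" "y \<in> carrier (pol_Y G)" "(x, y) \<in> pol_R G" for x y
  proof (rule ccontr)
    assume "(hX x, hY y) \<notin> pol_R G'"
    moreover have in': "hX x \<in> carrier (pol_X G')" "hY y \<in> carrier (pol_Y G')"
      using isos xy by (auto simp: order_iso_def order_embedding_iff Pi_iff)
    ultimately have "(hX x, hY y) \<in> (carrier (pol_X G') \<times> carrier (pol_Y G')) - pol_R G'"
      by blast
    from bspec[OF M3 this] obtain x0 y0 where 0: "x0 \<in> carrier (pol_X G)" "y0 \<in> carrier (pol_Y G)"
      "{a \<in> carrier (pol_X G). hX x \<sqsubseteq>\<^bsub>pol_X G'\<^esub> hX a} \<subseteq> {a \<in> carrier (pol_X G). x0 \<sqsubseteq>\<^bsub>pol_X G\<^esub> a}"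
      "{b \<in> carrier (pol_Y G). hY b \<sqsubseteq>\<^bsub>pol_Y G'\<^esub> hY y} \<subseteq> {b \<in> carrier (pol_Y G). b \<sqsubseteq>\<^bsub>pol_Y G\<^esub> y0}"
      "(x0, y0) \<notin> pol_R G"
      by (elim case_prodE bexE conjE) simp
    \<comment> \<open>Put \<open>a = x\<close> and \<open>b = y\<close> in the two inclusions; their
      premises hold by reflexivity in X' and Y'.\<close>
    have "x0 \<sqsubseteq>\<^bsub>pol_X G\<^esub> x" "y \<sqsubseteq>\<^bsub>pol_Y G\<^esub> y0"
      using 0 xy in' isos by (auto simp: order_iso_def order_embedding_iff partial_order_le_refl)
    then have "(x0, y0) \<in> pol_R G"
      using coherent3_C1[OF coh 0(1) xy(1,2) _ xy(3)] coherent3_C2[OF coh 0(1) xy(2) 0(2)] by blast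
    with 0 show False by blast
  qed
  show ?thesis
    unfolding polarity_strict_iso_def using isos M1 R pres by blast
qed

lemma polarity_iso_via_iff:
  "galois_polarity G \<Longrightarrow> polarity_iso_via G G' hX hP hY \<longleftrightarrow> polarity_strict_iso G G' hX hP hY"
  by (meson galois_polarity_def iso_via_imp_strict_iso strict_iso_imp_iso_via)

section \<open>Identities, composites and inverses of strict isomorphisms\<close>

lemma strict_iso_id:
  "extension_polarity G \<Longrightarrow> polarity_strict_iso G G id id id"
  by (auto simp: polarity_strict_iso_def extension_polarity_def order_embedding_iff order_iso_id)

lemma strict_iso_compose:
  assumes "extension_polarity G"
    and "polarity_strict_iso G G' hX hP hY" "polarity_strict_iso G' G'' kX kP kY"
  shows "polarity_strict_iso G G'' (kX \<circ> hX) (kP \<circ> hP) (kY \<circ> hY)"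
proof -
  have "hX \<in> carrier (pol_X G) \<rightarrow> carrier (pol_X G')" "hP \<in> carrier (pol_P G) \<rightarrow> carrier (pol_P G')"
    "hY \<in> carrier (pol_Y G) \<rightarrow> carrier (pol_Y G')"
    using assms(2) by (auto simp: polarity_strict_iso_def order_iso_def order_embedding_iff)
  then show ?thesis
    using assms by (auto simp: polarity_strict_iso_def Pi_iff intro: order_iso_compose)
qed

text \<open>The inverse on \<open>P\<close> is a parameter, so that it can be chosen to be \<^term>\<open>id\<close>.\<close>
lemma strict_iso_inverse:
  assumes ext: "extension_polarity G" and iso: "polarity_strict_iso G G' hX hP hY"
    and gP: "\<And>p. p \<in> carrier (pol_P G) \<Longrightarrow> gP (hP p) = p"
  shows "\<exists>gX gY. polarity_strict_iso G' G gX gP gY"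
proof -
  have isos: "order_iso (pol_X G) (pol_X G') hX" "order_iso (pol_P G) (pol_P G') hP"
    "order_iso (pol_Y G) (pol_Y G') hY"
    using iso by (auto simp: polarity_strict_iso_def)
  define gX where "gX = inv_into (carrier (pol_X G)) hX"
  define gY where "gY = inv_into (carrier (pol_Y G)) hY"
  have gX: "gX (hX x) = x" if "x \<in> carrier (pol_X G)" for x
    using isos that by (simp add: gX_def order_iso_def bij_betw_def)
  have gY: "gY (hY x) = x" if "x \<in> carrier (pol_Y G)" for x
    using isos that by (simp add: gY_def order_iso_def bij_betw_def)
  have e: "pol_eX G p \<in> carrier (pol_X G)" "pol_eY G p \<in> carrier (pol_Y G)"
    if "p \<in> carrier (pol_P G)" for p
    using that ext by (auto simp: extension_polarity_def order_embedding_iff Pi_iff)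
  have commute: "gX (pol_eX G' p') = pol_eX G (gP p') \<and> gY (pol_eY G' p') = pol_eY G (gP p')"
    if p': "p' \<in> carrier (pol_P G')" for p'
  proof -
    obtain p where p: "p \<in> carrier (pol_P G)" "p' = hP p"
      by (rule order_iso_pre_image[OF isos(2) p'])
    then have "pol_eX G' p' = hX (pol_eX G p)" "pol_eY G' p' = hY (pol_eY G p)"
      using iso by (auto simp: polarity_strict_iso_def)
    with p show ?thesis by (simp add: gX gY gP e)
  qed
  have R: "(gX x', gY y') \<in> pol_R G \<longleftrightarrow> (x', y') \<in> pol_R G'"
    if asm: "x' \<in> carrier (pol_X G')" "y' \<in> carrier (pol_Y G')" for x' y'
  proof -
    obtain x where x: "x \<in> carrier (pol_X G)" "x' = hX x"
      by (rule order_iso_pre_image[OF isos(1) asm(1)])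
    obtain y where y: "y \<in> carrier (pol_Y G)" "y' = hY y"
      by (rule order_iso_pre_image[OF isos(3) asm(2)])
    show ?thesis using x y iso by (simp add: gX gY polarity_strict_iso_def)
  qed
  have "polarity_strict_iso G' G gX gP gY"
    unfolding polarity_strict_iso_def
    using commute R isos gX gY gP by (auto intro: order_iso_inverse)
  then show ?thesis by blast
qed

section \<open>The polarity generated by a \<open>\<Delta>\<^sub>1\<close>-completion\<close>

text \<open>If \<open>m\<close> is the meet of the images of some \<open>S\<close>, enlarging
  \<open>S\<close> to all \<open>p\<close> whose image lies above \<open>m\<close> does not change
  the meet. This canonical choice removes the quantifier over \<open>S\<close>, leaving a condition
  that dualises and transports along isomorphisms.\<close>

lemma base_meets_iff:
  assumes emb: "order_embedding (ext_dom d) (ext_cod d) (ext_map d)"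
  shows "m \<in> base_meets d \<longleftrightarrow> m \<in> carrier (ext_cod d) \<and> (\<forall>l\<in>carrier (ext_cod d). l \<sqsubseteq>\<^bsub>ext_cod d\<^esub> m \<longleftrightarrow>
    (\<forall>p\<in>carrier (ext_dom d). m \<sqsubseteq>\<^bsub>ext_cod d\<^esub> ext_map d p \<longrightarrow> l \<sqsubseteq>\<^bsub>ext_cod d\<^esub> ext_map d p))"
    (is "_ \<longleftrightarrow> ?rhs")
proof -
  let ?D = "ext_cod d" and ?e = "ext_map d"
  have po: "partial_order ?D" and e: "\<And>p. p \<in> carrier (ext_dom d) \<Longrightarrow> ?e p \<in> carrier ?D"
    using emb by (auto simp: order_embedding_iff)
  have glb: "is_glb ?D m (?e ` S) \<longleftrightarrow>
      m \<in> carrier ?D \<and> (\<forall>l\<in>carrier ?D. l \<sqsubseteq>\<^bsub>?D\<^esub> m \<longleftrightarrow> (\<forall>p\<in>S. l \<sqsubseteq>\<^bsub>?D\<^esub> ?e p))"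
    if "S \<subseteq> carrier (ext_dom d)" for S
    using is_glb_iff[OF po, of "?e ` S" m] that e by (auto simp: image_subset_iff)
  show ?thesis
  proof
    assume "m \<in> base_meets d"
    then obtain S where S: "S \<subseteq> carrier (ext_dom d)" "is_glb ?D m (?e ` S)"
      by (auto simp: base_meets_def)
    with glb have m: "m \<in> carrier ?D" "\<And>l. l \<in> carrier ?D \<Longrightarrow> l \<sqsubseteq>\<^bsub>?D\<^esub> m \<longleftrightarrow> (\<forall>p\<in>S. l \<sqsubseteq>\<^bsub>?D\<^esub> ?e p)"
      by blast+
    then have "\<And>p. p \<in> S \<Longrightarrow> m \<sqsubseteq>\<^bsub>?D\<^esub> ?e p"
      using partial_order_le_refl[OF po] by blast
    with m S show ?rhs
      using partial_order_le_trans[OF po] e by (meson subsetD)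
  next
    assume "?rhs"
    then have "is_glb ?D m (?e ` {p \<in> carrier (ext_dom d). m \<sqsubseteq>\<^bsub>?D\<^esub> ?e p})"
      by (subst glb) auto
    then show "m \<in> base_meets d"
      unfolding base_meets_def mem_Collect_eq
      by (intro exI[of _ "{p \<in> carrier (ext_dom d). m \<sqsubseteq>\<^bsub>?D\<^esub> ?e p}"]) auto
  qed
qed

text \<open>Reversing both orders exchanges base meets and base joins, so facts about joins can be
  read off from facts about meets.\<close>

definition dual_extension :: "('p, 'd) extension \<Rightarrow> ('p, 'd) extension" where
  "dual_extension d =
     \<lparr>ext_dom = inv_gorder (ext_dom d), ext_cod = inv_gorder (ext_cod d), ext_map = ext_map d\<rparr>"

lemma dual_extension_sel [simp]:
  "ext_dom (dual_extension d) = inv_gorder (ext_dom d)"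
  "ext_cod (dual_extension d) = inv_gorder (ext_cod d)"
  "ext_map (dual_extension d) = ext_map d"
  by (simp_all add: dual_extension_def)

lemma base_meets_dual_extension: "base_meets (dual_extension d) = base_joins d"
  by (simp add: base_meets_def base_joins_def)

lemma order_embedding_dual:
  "order_embedding P Q e \<Longrightarrow> order_embedding (inv_gorder P) (inv_gorder Q) e"
  by (simp add: order_embedding_iff partial_order_dual)

lemma base_joins_iff:
  assumes emb: "order_embedding (ext_dom d) (ext_cod d) (ext_map d)"
  shows "j \<in> base_joins d \<longleftrightarrow> j \<in> carrier (ext_cod d) \<and> (\<forall>u\<in>carrier (ext_cod d). j \<sqsubseteq>\<^bsub>ext_cod d\<^esub> u \<longleftrightarrow>
    (\<forall>p\<in>carrier (ext_dom d). ext_map d p \<sqsubseteq>\<^bsub>ext_cod d\<^esub> j \<longrightarrow> ext_map d p \<sqsubseteq>\<^bsub>ext_cod d\<^esub> u))"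
  using base_meets_iff[of "dual_extension d" j] order_embedding_dual[OF emb]
  by (simp add: base_meets_dual_extension)

lemma ext_map_in_base:
  assumes emb: "order_embedding (ext_dom d) (ext_cod d) (ext_map d)"
    and p: "p \<in> carrier (ext_dom d)"
  shows "ext_map d p \<in> base_meets d" "ext_map d p \<in> base_joins d"
proof -
  have po: "partial_order (ext_cod d)" and e: "\<And>p. p \<in> carrier (ext_dom d) \<Longrightarrow> ext_map d p \<in> carrier (ext_cod d)"
    using emb by (auto simp: order_embedding_iff)
  show "ext_map d p \<in> base_meets d" "ext_map d p \<in> base_joins d"
    unfolding base_meets_iff[OF emb] base_joins_iff[OF emb]
    using p e partial_order_le_refl[OF po] partial_order_le_trans[OF po] by meson+
qed

text \<open>A meet of meets is one meet: an image of P above some \<open>m\<close> in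
  \<open>M\<close> is also above \<open>z\<close>, so a lower bound of the images above
  \<open>z\<close> lies below every such \<open>m\<close>, and hence below \<open>z\<close>. This is
  the source of completeness of X.\<close>

lemma base_meets_closed:
  assumes emb: "order_embedding (ext_dom d) (ext_cod d) (ext_map d)"
    and M: "M \<subseteq> base_meets d" and z: "is_glb (ext_cod d) z M"
  shows "z \<in> base_meets d"
proof -
  let ?D = "ext_cod d" and ?e = "ext_map d"
  have po: "partial_order ?D" and e: "\<And>p. p \<in> carrier (ext_dom d) \<Longrightarrow> ?e p \<in> carrier ?D"
    using emb by (auto simp: order_embedding_iff)
  have MD: "M \<subseteq> carrier ?D"
    using M base_meets_iff[OF emb] by blast
  have z': "z \<in> carrier ?D" "\<And>l. l \<in> carrier ?D \<Longrightarrow> l \<sqsubseteq>\<^bsub>?D\<^esub> z \<longleftrightarrow> (\<forall>m\<in>M. l \<sqsubseteq>\<^bsub>?D\<^esub> m)"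
    using z is_glb_iff[OF po MD] by blast+
  have "l \<sqsubseteq>\<^bsub>?D\<^esub> z"
    if l: "l \<in> carrier ?D"
      "\<And>p. p \<in> carrier (ext_dom d) \<Longrightarrow> z \<sqsubseteq>\<^bsub>?D\<^esub> ?e p \<Longrightarrow> l \<sqsubseteq>\<^bsub>?D\<^esub> ?e p" for l
  proof -
    have "l \<sqsubseteq>\<^bsub>?D\<^esub> m" if m: "m \<in> M" for m
    proof -
      have "z \<sqsubseteq>\<^bsub>?D\<^esub> m"
        using z' m partial_order_le_refl[OF po] by blast
      then have "\<forall>p\<in>carrier (ext_dom d). m \<sqsubseteq>\<^bsub>?D\<^esub> ?e p \<longrightarrow> l \<sqsubseteq>\<^bsub>?D\<^esub> ?e p"
        using l(2) partial_order_le_trans[OF po _ _ z'(1)] m MD e by blast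
      then show ?thesis
        using m M l(1) base_meets_iff[OF emb, of m] by blast
    qed
    then show ?thesis
      using z' l(1) by blast
  qed
  then show ?thesis
    unfolding base_meets_iff[OF emb]
    using z' e partial_order_le_trans[OF po] by meson
qed

lemma base_joins_closed:
  assumes "order_embedding (ext_dom d) (ext_cod d) (ext_map d)"
    and "J \<subseteq> base_joins d" "is_lub (ext_cod d) z J"
  shows "z \<in> base_joins d"
  using base_meets_closed[of "dual_extension d" J z] order_embedding_dual[OF assms(1)] assms(2,3)
  by (simp add: base_meets_dual_extension)

section \<open>The generated polarity is a complete Galois polarity\<close>

lemma generated_polarity_sel [simp]:
  "pol_P (generated_polarity d) = ext_dom d"
  "pol_X (generated_polarity d) =
     \<lparr>carrier = Inl ` base_meets d, eq = (=), le = (\<lambda>u v. projl u \<sqsubseteq>\<^bsub>ext_cod d\<^esub> projl v)\<rparr>"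
  "pol_Y (generated_polarity d) =
     \<lparr>carrier = Inr ` base_joins d, eq = (=), le = (\<lambda>u v. projr u \<sqsubseteq>\<^bsub>ext_cod d\<^esub> projr v)\<rparr>"
  "pol_eX (generated_polarity d) p = Inl (ext_map d p)"
  "pol_eY (generated_polarity d) p = Inr (ext_map d p)"
  by (simp_all add: generated_polarity_def)

lemma generated_polarity_R [simp]:
  "(u, v) \<in> pol_R (generated_polarity d) \<longleftrightarrow>
     (\<exists>x\<in>base_meets d. \<exists>y\<in>base_joins d. u = Inl x \<and> v = Inr y \<and> x \<sqsubseteq>\<^bsub>ext_cod d\<^esub> y)"
  by (auto simp: generated_polarity_def)

text \<open>By \<open>base_meets_closed\<close>, meets in X are those of the completion, and meets
  alone suffice for completeness; joins in X may differ from the ambient ones. The meet-extension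
  property is \<open>base_meets_iff\<close> restricted to base meets.\<close>

lemma generated_polarity_X:
  assumes "completion (ext_dom d) (ext_cod d) (ext_map d)"
  defines "X \<equiv> pol_X (generated_polarity d)"
  shows "completion (ext_dom d) X (pol_eX (generated_polarity d))"
    and "meet_extension (ext_dom d) X (pol_eX (generated_polarity d))"
proof -
  let ?D = "ext_cod d" and ?e = "ext_map d" and ?eX = "pol_eX (generated_polarity d)"
  have emb: "order_embedding (ext_dom d) ?D ?e" and cl: "complete_lattice ?D"
    using assms by (auto simp: completion_def)
  then have po: "partial_order ?D"
    by (simp add: order_embedding_def)
  have carrier_X: "carrier X = Inl ` base_meets d"
    and le_X: "\<And>x x'. Inl x \<sqsubseteq>\<^bsub>X\<^esub> Inl x' \<longleftrightarrow> x \<sqsubseteq>\<^bsub>?D\<^esub> x'"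
    by (simp_all add: X_def)
  have MD: "base_meets d \<subseteq> carrier ?D"
    using base_meets_iff[OF emb] by blast
  have po_X: "partial_order X"
    unfolding X_def generated_polarity_sel
    by (rule partial_order_pullback[OF po]) (use MD in \<open>auto intro!: inj_onI\<close>)
  have emb_X: "order_embedding (ext_dom d) X ?eX"
    using emb po_X ext_map_in_base[OF emb]
    by (auto simp: order_embedding_iff carrier_X le_X)
  have "complete_lattice X"
  proof (rule complete_lattice_if_glbs[OF po_X])
    fix A assume A: "A \<subseteq> carrier X"
    define M where "M = {m. Inl m \<in> A}"
    have M: "M \<subseteq> base_meets d" "A = Inl ` M"
      using A by (auto simp: M_def carrier_X)
    obtain z where z: "is_glb ?D z M"
      using complete_lattice_glb_exists[OF cl] M MD by (meson order_trans)
    then have "z \<in> base_meets d"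
      by (rule base_meets_closed[OF emb M(1)])
    then have "is_glb X (Inl z) A"
      using z M MD unfolding is_glb_iff[OF po_X A] is_glb_iff[OF po subset_trans[OF M(1) MD]]
      by (auto simp: carrier_X le_X)
    then show "\<exists>x. is_glb X x A" by blast
  qed
  with emb_X show "completion (ext_dom d) X ?eX"
    by (simp add: completion_def)
  show "meet_extension (ext_dom d) X ?eX"
    unfolding meet_extension_def
  proof (intro conjI emb_X ballI)
    fix q assume "q \<in> carrier X"
    then obtain m where m: "q = Inl m" "m \<in> base_meets d"
      by (auto simp: carrier_X)
    have sub: "?eX ` {p \<in> carrier (ext_dom d). q \<sqsubseteq>\<^bsub>X\<^esub> ?eX p} \<subseteq> carrier X"
      using emb_X by (auto simp: order_embedding_iff)
    show "is_glb X q (?eX ` {p \<in> carrier (ext_dom d). q \<sqsubseteq>\<^bsub>X\<^esub> ?eX p})"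
      unfolding is_glb_iff[OF po_X sub]
      using m MD base_meets_iff[OF emb, of m] by (auto simp: carrier_X le_X subset_iff)
  qed
qed

text \<open>The argument is repeated for joins because passing to \<open>dual_extension\<close>
  would also exchange the tags \<open>Inl\<close> and \<open>Inr\<close>.\<close>

lemma generated_polarity_Y:
  assumes "completion (ext_dom d) (ext_cod d) (ext_map d)"
  defines "Y \<equiv> pol_Y (generated_polarity d)"
  shows "completion (ext_dom d) Y (pol_eY (generated_polarity d))"
    and "join_extension (ext_dom d) Y (pol_eY (generated_polarity d))"
proof -
  let ?D = "ext_cod d" and ?e = "ext_map d" and ?eY = "pol_eY (generated_polarity d)"
  have emb: "order_embedding (ext_dom d) ?D ?e" and cl: "complete_lattice ?D"
    using assms by (auto simp: completion_def)
  then have po: "partial_order ?D"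
    by (simp add: order_embedding_def)
  have carrier_Y: "carrier Y = Inr ` base_joins d"
    and le_Y: "\<And>y y'. Inr y \<sqsubseteq>\<^bsub>Y\<^esub> Inr y' \<longleftrightarrow> y \<sqsubseteq>\<^bsub>?D\<^esub> y'"
    by (simp_all add: Y_def)
  have JD: "base_joins d \<subseteq> carrier ?D"
    using base_joins_iff[OF emb] by blast
  have po_Y: "partial_order Y"
    unfolding Y_def generated_polarity_sel
    by (rule partial_order_pullback[OF po]) (use JD in \<open>auto intro!: inj_onI\<close>)
  have emb_Y: "order_embedding (ext_dom d) Y ?eY"
    using emb po_Y ext_map_in_base[OF emb]
    by (auto simp: order_embedding_iff carrier_Y le_Y)
  have "complete_lattice Y"
  proof (rule complete_lattice_if_lubs[OF po_Y])
    fix A assume A: "A \<subseteq> carrier Y"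
    define J where "J = {j. Inr j \<in> A}"
    have J: "J \<subseteq> base_joins d" "A = Inr ` J"
      using A by (auto simp: J_def carrier_Y)
    obtain z where z: "is_lub ?D z J"
      using complete_lattice_lub_exists[OF cl] J JD by (meson order_trans)
    then have "z \<in> base_joins d"
      by (rule base_joins_closed[OF emb J(1)])
    then have "is_lub Y (Inr z) A"
      using z J JD unfolding is_lub_iff[OF po_Y A] is_lub_iff[OF po subset_trans[OF J(1) JD]]
      by (auto simp: carrier_Y le_Y)
    then show "\<exists>x. is_lub Y x A" by blast
  qed
  with emb_Y show "completion (ext_dom d) Y ?eY"
    by (simp add: completion_def)
  show "join_extension (ext_dom d) Y ?eY"
    unfolding join_extension_def
  proof (intro conjI emb_Y ballI)
    fix q assume "q \<in> carrier Y"
    then obtain j where j: "q = Inr j" "j \<in> base_joins d"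
      by (auto simp: carrier_Y)
    have sub: "?eY ` {p \<in> carrier (ext_dom d). ?eY p \<sqsubseteq>\<^bsub>Y\<^esub> q} \<subseteq> carrier Y"
      using emb_Y by (auto simp: order_embedding_iff)
    show "is_lub Y q (?eY ` {p \<in> carrier (ext_dom d). ?eY p \<sqsubseteq>\<^bsub>Y\<^esub> q})"
      unfolding is_lub_iff[OF po_Y sub]
      using j JD base_joins_iff[OF emb, of j] by (auto simp: carrier_Y le_Y subset_iff)
  qed
qed

text \<open>(C3) is reflexivity in the completion, and the other conditions up to (C6) are
  transitivity. (C7) and (C8) are different: their meets and joins are taken inside X and Y, so they
  only give information about elements of X, respectively Y.\<close>

lemma generated_polarity_coherent:
  assumes "completion (ext_dom d) (ext_cod d) (ext_map d)"
  shows "coherent3 (generated_polarity d)"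
proof -
  let ?D = "ext_cod d" and ?e = "ext_map d" and ?P = "ext_dom d"
    and ?X = "pol_X (generated_polarity d)" and ?Y = "pol_Y (generated_polarity d)"
    and ?eX = "pol_eX (generated_polarity d)" and ?eY = "pol_eY (generated_polarity d)"
  have emb: "order_embedding ?P ?D ?e"
    using assms by (auto simp: completion_def)
  then have po: "partial_order ?D"
    by (simp add: order_embedding_def)
  have po_X: "partial_order ?X" and po_Y: "partial_order ?Y"
    using generated_polarity_X[OF assms] generated_polarity_Y[OF assms]
    by (simp_all add: completion_def order_embedding_def)
  have MD: "base_meets d \<subseteq> carrier ?D" and JD: "base_joins d \<subseteq> carrier ?D"
    using base_meets_iff[OF emb] base_joins_iff[OF emb] by blast+
  note in_base = ext_map_in_base[OF emb]
  have trans: "x \<sqsubseteq>\<^bsub>?D\<^esub> y \<Longrightarrow> y \<sqsubseteq>\<^bsub>?D\<^esub> z \<Longrightarrow> x \<sqsubseteq>\<^bsub>?D\<^esub> z"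
    if "{x, y, z} \<subseteq> base_meets d \<union> base_joins d" for x y z
    using partial_order_le_trans[OF po, of x y z] that MD JD by blast
  have C7: "j1 \<sqsubseteq>\<^bsub>?D\<^esub> j2"
    if asm: "S \<subseteq> carrier ?P" "m \<in> base_meets d" "j1 \<in> base_joins d" "j2 \<in> base_joins d"
      "is_glb ?X (Inl m) (?eX ` S)" "m \<sqsubseteq>\<^bsub>?D\<^esub> j2" "\<And>p. p \<in> S \<Longrightarrow> j1 \<sqsubseteq>\<^bsub>?D\<^esub> ?e p" for S m j1 j2
  proof -
    have "?eX ` S \<subseteq> carrier ?X"
      using asm(1) in_base by auto
    then have m: "l \<sqsubseteq>\<^bsub>?D\<^esub> m" if "l \<in> base_meets d" "\<And>p. p \<in> S \<Longrightarrow> l \<sqsubseteq>\<^bsub>?D\<^esub> ?e p" for l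
      using asm(5) that is_glb_iff[OF po_X] by auto
    \<comment> \<open>The meet \<open>m\<close> is taken in X, where \<open>j1\<close> need not
      occur. But \<open>j1\<close> is the join of the images of P below it, and those images are
      base meets, so \<open>m\<close> can be compared with each of them.\<close>
    have "?e q \<sqsubseteq>\<^bsub>?D\<^esub> j2" if q: "q \<in> carrier ?P" "?e q \<sqsubseteq>\<^bsub>?D\<^esub> j1" for q
    proof -
      have "?e q \<sqsubseteq>\<^bsub>?D\<^esub> m"
        using asm(1,3,7) q in_base trans[of "?e q" j1] by (intro m) blast+
      then show ?thesis
        using asm q in_base trans[of "?e q" m j2] by blast
    qed
    then show ?thesis
      using asm(3,4) base_joins_iff[OF emb, of j1] JD by blast
  qed
  have C8: "m1 \<sqsubseteq>\<^bsub>?D\<^esub> m2"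
    if asm: "T \<subseteq> carrier ?P" "j \<in> base_joins d" "m1 \<in> base_meets d" "m2 \<in> base_meets d"
      "is_lub ?Y (Inr j) (?eY ` T)" "m1 \<sqsubseteq>\<^bsub>?D\<^esub> j" "\<And>p. p \<in> T \<Longrightarrow> ?e p \<sqsubseteq>\<^bsub>?D\<^esub> m2" for T j m1 m2
  proof -
    have "?eY ` T \<subseteq> carrier ?Y"
      using asm(1) in_base by auto
    then have j: "j \<sqsubseteq>\<^bsub>?D\<^esub> u" if "u \<in> base_joins d" "\<And>p. p \<in> T \<Longrightarrow> ?e p \<sqsubseteq>\<^bsub>?D\<^esub> u" for u
      using asm(5) that is_lub_iff[OF po_Y] by auto
    \<comment> \<open>Dually, \<open>m2\<close> is the meet of the images above it, and these lie in
      Y, where \<open>j\<close> is a join.\<close>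
    have "m1 \<sqsubseteq>\<^bsub>?D\<^esub> ?e q" if q: "q \<in> carrier ?P" "m2 \<sqsubseteq>\<^bsub>?D\<^esub> ?e q" for q
    proof -
      have "j \<sqsubseteq>\<^bsub>?D\<^esub> ?e q"
        using asm(1,4,7) q in_base trans[of _ m2 "?e q"] by (intro j) blast+
      then show ?thesis
        using asm q in_base trans[of m1 j "?e q"] by blast
    qed
    then show ?thesis
      using asm(3,4) base_meets_iff[OF emb, of m2] MD by blast
  qed
  show ?thesis
    unfolding coherent3_def Let_def
  proof (intro conjI allI impI ballI, goal_cases)
    case (1 x1 x2 y)
    then show ?case by (auto intro: trans)
  next
    case (2 x y1 y2)
    then show ?case by (auto intro: trans)
  next
    case (3 p)
    then show ?case using in_base po MD by (auto intro!: partial_order_le_refl)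
  next
    case (4 x y p)
    then show ?case using in_base by (auto intro: trans[of _ "?e p"])
  next
    case (5 x1 x2 p)
    then show ?case using in_base by (auto intro: trans[of _ "?e p"])
  next
    case (6 y1 y2 p)
    then show ?case using in_base by (auto intro: trans[of _ "?e p"])
  next
    case (7 S x y1 y2)
    then obtain m j1 j2 where eq: "x = Inl m" "y1 = Inr j1" "y2 = Inr j2"
      and base: "m \<in> base_meets d" "j1 \<in> base_joins d" "j2 \<in> base_joins d"
      by auto
    note asm = 7(5)[THEN conjunct1] 7(5)[THEN conjunct2, THEN conjunct1]
      7(5)[THEN conjunct2, THEN conjunct2]
    have "j1 \<sqsubseteq>\<^bsub>?D\<^esub> j2"
    proof (rule C7)
      show "S \<subseteq> carrier ?P"
        using 7(1) by simp
      show "is_glb ?X (Inl m) (?eX ` S)"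
        using asm(1) unfolding eq .
      show "m \<sqsubseteq>\<^bsub>?D\<^esub> j2"
        using asm(2) eq by simp
      show "\<And>p. p \<in> S \<Longrightarrow> j1 \<sqsubseteq>\<^bsub>?D\<^esub> ?e p"
        using asm(3) eq by simp
    qed (use base in auto)
    then show ?case
      by (simp add: eq)
  next
    case (8 T y x1 x2)
    then obtain j m1 m2 where eq: "y = Inr j" "x1 = Inl m1" "x2 = Inl m2"
      and base: "j \<in> base_joins d" "m1 \<in> base_meets d" "m2 \<in> base_meets d"
      by auto
    note asm = 8(5)[THEN conjunct1] 8(5)[THEN conjunct2, THEN conjunct1]
      8(5)[THEN conjunct2, THEN conjunct2]
    have "m1 \<sqsubseteq>\<^bsub>?D\<^esub> m2"
    proof (rule C8)
      show "T \<subseteq> carrier ?P"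
        using 8(1) by simp
      show "is_lub ?Y (Inr j) (?eY ` T)"
        using asm(1) unfolding eq .
      show "m1 \<sqsubseteq>\<^bsub>?D\<^esub> j"
        using asm(2) eq by simp
      show "\<And>p. p \<in> T \<Longrightarrow> ?e p \<sqsubseteq>\<^bsub>?D\<^esub> m2"
        using asm(3) eq by simp
    qed (use base in auto)
    then show ?case
      by (simp add: eq)
  qed
qed

lemma delta1_imp_completion:
  "delta1_completion d \<Longrightarrow> completion (ext_dom d) (ext_cod d) (ext_map d)"
  unfolding delta1_completion_def by (rule conjunct1)

lemma generated_polarity_complete_galois:
  assumes "delta1_completion d"
  shows "complete_galois_polarity (generated_polarity d)"
proof -
  have compl: "completion (ext_dom d) (ext_cod d) (ext_map d)"
    by (rule delta1_imp_completion[OF assms])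
  note X = generated_polarity_X[OF compl] and Y = generated_polarity_Y[OF compl]
  have "carrier (pol_X (generated_polarity d)) \<inter> carrier (pol_Y (generated_polarity d)) = {}"
    "pol_R (generated_polarity d)
      \<subseteq> carrier (pol_X (generated_polarity d)) \<times> carrier (pol_Y (generated_polarity d))"
    by auto
  then have "extension_polarity (generated_polarity d)"
    using X(1) Y(1) unfolding extension_polarity_def completion_def generated_polarity_sel(1)
    by (intro conjI) (erule conjunct1 | assumption)+
  then show ?thesis
    unfolding complete_galois_polarity_def galois_polarity_def generated_polarity_sel(1)
    by (intro conjI X Y generated_polarity_coherent[OF compl])
qed

section \<open>Isomorphic completions and isomorphic polarities\<close>

text \<open>After \<open>base_meets_iff\<close> membership mentions only the order, the embedding
  and the carriers; writing the carriers of \<open>d2\<close> as images turns one condition into the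
  other.\<close>

lemma iso_base_meets:
  assumes emb1: "order_embedding (ext_dom d1) (ext_cod d1) (ext_map d1)"
    and emb2: "order_embedding (ext_dom d2) (ext_cod d2) (ext_map d2)"
    and via: "extension_iso_via d1 d2 gP gQ"
  shows "gQ ` base_meets d1 = base_meets d2"
proof -
  have P2: "carrier (ext_dom d2) = gP ` carrier (ext_dom d1)"
    and D2: "carrier (ext_cod d2) = gQ ` carrier (ext_cod d1)"
    using via by (auto simp: extension_iso_via_def order_iso_def bij_betw_def)
  have le: "gQ x \<sqsubseteq>\<^bsub>ext_cod d2\<^esub> gQ y \<longleftrightarrow> x \<sqsubseteq>\<^bsub>ext_cod d1\<^esub> y"
    if "x \<in> carrier (ext_cod d1)" "y \<in> carrier (ext_cod d1)" for x y
    using via that by (auto simp: extension_iso_via_def order_iso_def order_embedding_iff)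
  have e2: "ext_map d2 (gP p) = gQ (ext_map d1 p)" if "p \<in> carrier (ext_dom d1)" for p
    using via that by (auto simp: extension_iso_via_def)
  have e1: "ext_map d1 p \<in> carrier (ext_cod d1)" if "p \<in> carrier (ext_dom d1)" for p
    using emb1 that by (auto simp: order_embedding_iff)
  have "gQ m \<in> base_meets d2 \<longleftrightarrow> m \<in> base_meets d1" if "m \<in> carrier (ext_cod d1)" for m
    using that unfolding base_meets_iff[OF emb1] base_meets_iff[OF emb2] P2 D2
    by (simp add: le e1 e2)
  moreover have "base_meets d1 \<subseteq> carrier (ext_cod d1)" "base_meets d2 \<subseteq> gQ ` carrier (ext_cod d1)"
    using base_meets_iff[OF emb1] base_meets_iff[OF emb2] D2 by blast+
  ultimately show ?thesis
    by blast
qed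

lemma order_iso_dual: "order_iso P Q f \<Longrightarrow> order_iso (inv_gorder P) (inv_gorder Q) f"
  by (simp add: order_iso_def order_embedding_dual)

lemma iso_base_joins:
  assumes "order_embedding (ext_dom d1) (ext_cod d1) (ext_map d1)"
    and "order_embedding (ext_dom d2) (ext_cod d2) (ext_map d2)"
    and "extension_iso_via d1 d2 gP gQ"
  shows "gQ ` base_joins d1 = base_joins d2"
  using iso_base_meets[of "dual_extension d1" "dual_extension d2" gP gQ]
    assms(1,2)[THEN order_embedding_dual] assms(3)
  by (simp add: base_meets_dual_extension extension_iso_via_def order_iso_dual)

lemma delta1_embedding:
  "delta1_completion d \<Longrightarrow> order_embedding (ext_dom d) (ext_cod d) (ext_map d)"
  using delta1_imp_completion[of d] by (simp add: completion_def)

text \<open>\<open>gQ\<close> restricts to base meets and to base joins, and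
  \<open>map_sum gQ gQ\<close> keeps the tags. As both orders and \<open>R\<close> are restrictions
  of the ambient order, all comparisons are instances of one fact about \<open>gQ\<close>.\<close>

lemma extension_iso_imp_strict_iso:
  assumes d1: "delta1_completion d1" and d2: "delta1_completion d2"
    and via: "extension_iso_via d1 d2 gP gQ"
  shows "polarity_strict_iso (generated_polarity d1) (generated_polarity d2)
    (map_sum gQ gQ) gP (map_sum gQ gQ)"
proof -
  note emb = delta1_embedding[OF d1] delta1_embedding[OF d2]
  note ext = generated_polarity_complete_galois[OF d1] generated_polarity_complete_galois[OF d2]
  have po: "partial_order (pol_X (generated_polarity d1))" "partial_order (pol_Y (generated_polarity d1))"
    "partial_order (pol_X (generated_polarity d2))" "partial_order (pol_Y (generated_polarity d2))"
    using ext unfolding complete_galois_polarity_def completion_def order_embedding_def by blast+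
  have M: "gQ ` base_meets d1 = base_meets d2" and J: "gQ ` base_joins d1 = base_joins d2"
    using iso_base_meets[OF emb via] iso_base_joins[OF emb via] .
  have sub: "base_meets d1 \<subseteq> carrier (ext_cod d1)" "base_joins d1 \<subseteq> carrier (ext_cod d1)"
    using base_meets_iff[OF emb(1)] base_joins_iff[OF emb(1)] by blast+
  have le: "gQ x \<sqsubseteq>\<^bsub>ext_cod d2\<^esub> gQ y \<longleftrightarrow> x \<sqsubseteq>\<^bsub>ext_cod d1\<^esub> y"
    if "x \<in> base_meets d1 \<union> base_joins d1" "y \<in> base_meets d1 \<union> base_joins d1" for x y
    using via that sub by (auto simp: extension_iso_via_def order_iso_def order_embedding_iff subset_iff)
  have "order_iso (pol_X (generated_polarity d1)) (pol_X (generated_polarity d2)) (map_sum gQ gQ)"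
    using po by (intro order_isoI) (auto simp: le image_image simp flip: M)
  moreover have "order_iso (pol_Y (generated_polarity d1)) (pol_Y (generated_polarity d2)) (map_sum gQ gQ)"
    using po by (intro order_isoI) (auto simp: le image_image simp flip: J)
  ultimately show ?thesis
    using via M J by (auto simp: polarity_strict_iso_def extension_iso_via_def le)
qed

text \<open>A set of base meets with join \<open>z\<close> may be enlarged to all base meets below
  \<open>z\<close>. This fixed test set is what allows two completions to be compared.\<close>

lemma delta1_join_dense:
  assumes d: "delta1_completion d" and z: "z \<in> carrier (ext_cod d)" and u: "u \<in> carrier (ext_cod d)"
  shows "z \<sqsubseteq>\<^bsub>ext_cod d\<^esub> u \<longleftrightarrow>
    (\<forall>m\<in>base_meets d. m \<sqsubseteq>\<^bsub>ext_cod d\<^esub> z \<longrightarrow> m \<sqsubseteq>\<^bsub>ext_cod d\<^esub> u)"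
proof -
  have po: "partial_order (ext_cod d)"
    using delta1_embedding[OF d] by (simp add: order_embedding_def)
  have sub: "base_meets d \<subseteq> carrier (ext_cod d)"
    using base_meets_iff[OF delta1_embedding[OF d]] by blast
  obtain M where M: "M \<subseteq> base_meets d" "is_lub (ext_cod d) z M"
    using d z unfolding delta1_completion_def by blast
  then have lub: "\<And>u. u \<in> carrier (ext_cod d) \<Longrightarrow>
      z \<sqsubseteq>\<^bsub>ext_cod d\<^esub> u \<longleftrightarrow> (\<forall>m\<in>M. m \<sqsubseteq>\<^bsub>ext_cod d\<^esub> u)"
    using is_lub_iff[OF po, of M z] sub by blast
  have "\<And>m. m \<in> M \<Longrightarrow> m \<sqsubseteq>\<^bsub>ext_cod d\<^esub> z"
    using lub[OF z] partial_order_le_refl[OF po z] by blast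
  then show ?thesis
    using lub[OF u] M(1) sub z u partial_order_le_trans[OF po _ _ _ z u] by blast
qed

lemma delta1_dual: "delta1_completion d \<Longrightarrow> delta1_completion (dual_extension d)"
proof -
  assume d: "delta1_completion d"
  have "base_joins (dual_extension d) = base_meets d"
    by (simp add: base_meets_def base_joins_def)
  moreover have "complete_lattice (inv_gorder (ext_cod d))"
    using delta1_imp_completion[OF d] unfolding completion_def by (intro complete_lattice_dual) simp
  ultimately show ?thesis
    using d order_embedding_dual[OF delta1_embedding[OF d]]
    unfolding delta1_completion_def completion_def base_meets_dual_extension dual_extension_sel
    by simp
qed

lemma delta1_meet_dense:
  assumes "delta1_completion d" "z \<in> carrier (ext_cod d)" "u \<in> carrier (ext_cod d)"
  shows "u \<sqsubseteq>\<^bsub>ext_cod d\<^esub> z \<longleftrightarrow>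
    (\<forall>j\<in>base_joins d. z \<sqsubseteq>\<^bsub>ext_cod d\<^esub> j \<longrightarrow> u \<sqsubseteq>\<^bsub>ext_cod d\<^esub> j)"
  using delta1_join_dense[of "dual_extension d" z u] assms
  by (simp add: delta1_dual base_meets_dual_extension)

text \<open>Meet-density in the form that identifies values of the isomorphism constructed next,
  which are known only through the base joins above them.\<close>

lemma delta1_eqI:
  assumes d: "delta1_completion d" and z: "z \<in> carrier (ext_cod d)" and u: "u \<in> carrier (ext_cod d)"
    and "\<And>j. j \<in> base_joins d \<Longrightarrow> z \<sqsubseteq>\<^bsub>ext_cod d\<^esub> j \<longleftrightarrow> u \<sqsubseteq>\<^bsub>ext_cod d\<^esub> j"
  shows "z = u"
proof (rule partial_order_le_antisym)
  show "partial_order (ext_cod d)"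
    using delta1_embedding[OF d] by (simp add: order_embedding_def)
qed (use assms delta1_meet_dense[OF d] in blast)+

text \<open>
  The isomorphism sends \<open>z\<close> to the join of the images of the elements of \<^term>\<open>base_meets d1\<close>
  below \<open>z\<close>. It is determined by which elements of \<^term>\<open>base_joins d2\<close> lie above its values,
  and these are the images of the elements of \<^term>\<open>base_joins d1\<close> above \<open>z\<close>.
\<close>
lemma strict_iso_imp_extension_iso:
  assumes d1: "delta1_completion d1" and d2: "delta1_completion d2"
    and iso: "polarity_strict_iso (generated_polarity d1) (generated_polarity d2) hX hP hY"
  shows "\<exists>gQ. extension_iso_via d1 d2 hP gQ"
proof -
  let ?D1 = "ext_cod d1" and ?D2 = "ext_cod d2"
  note emb1 = delta1_embedding[OF d1] and emb2 = delta1_embedding[OF d2]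
  have po1: "partial_order ?D1" and po2: "partial_order ?D2" and cl2: "complete_lattice ?D2"
    using d1[THEN delta1_imp_completion] d2[THEN delta1_imp_completion]
    unfolding completion_def order_embedding_def by blast+
  have sub1: "base_meets d1 \<subseteq> carrier ?D1" "base_joins d1 \<subseteq> carrier ?D1"
    using base_meets_iff[OF emb1] base_joins_iff[OF emb1] by blast+
  have sub2: "base_meets d2 \<subseteq> carrier ?D2" "base_joins d2 \<subseteq> carrier ?D2"
    using base_meets_iff[OF emb2] base_joins_iff[OF emb2] by blast+
  define h where "h m = projl (hX (Inl m))" for m
  define k where "k j = projr (hY (Inr j))" for j
  have imX: "hX ` Inl ` base_meets d1 = Inl ` base_meets d2"
    and imY: "hY ` Inr ` base_joins d1 = Inr ` base_joins d2"
    using iso by (auto simp: polarity_strict_iso_def order_iso_def bij_betw_def)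
  have hX: "hX (Inl m) = Inl (h m)" if "m \<in> base_meets d1" for m
  proof -
    have "hX (Inl m) \<in> Inl ` base_meets d2"
      using that by (intro equalityD1[OF imX, THEN subsetD] imageI)
    then show ?thesis
      by (auto simp: h_def)
  qed
  have hY: "hY (Inr j) = Inr (k j)" if "j \<in> base_joins d1" for j
  proof -
    have "hY (Inr j) \<in> Inr ` base_joins d2"
      using that by (intro equalityD1[OF imY, THEN subsetD] imageI)
    then show ?thesis
      by (auto simp: k_def)
  qed
  have h_im: "h ` base_meets d1 = base_meets d2"
    unfolding h_def using arg_cong[OF imX, of "image projl"] by (simp add: image_image)
  have k_im: "k ` base_joins d1 = base_joins d2"
    unfolding k_def using arg_cong[OF imY, of "image projr"] by (simp add: image_image)
  have R: "h m \<sqsubseteq>\<^bsub>?D2\<^esub> k j \<longleftrightarrow> m \<sqsubseteq>\<^bsub>?D1\<^esub> j" if "m \<in> base_meets d1" "j \<in> base_joins d1" for m j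
  proof -
    have "h m \<in> base_meets d2" "k j \<in> base_joins d2"
      using that h_im k_im by auto
    moreover have "(hX (Inl m), hY (Inr j)) \<in> pol_R (generated_polarity d2) \<longleftrightarrow>
        (Inl m, Inr j) \<in> pol_R (generated_polarity d1)"
      using iso that by (simp add: polarity_strict_iso_def)
    ultimately show ?thesis
      using that by (simp add: hX hY)
  qed
  have "\<exists>w. is_lub ?D2 w (h ` {m \<in> base_meets d1. m \<sqsubseteq>\<^bsub>?D1\<^esub> z})" for z
    using h_im sub2 by (intro complete_lattice_lub_exists[OF cl2]) blast
  then obtain g where g: "\<And>z. is_lub ?D2 (g z) (h ` {m \<in> base_meets d1. m \<sqsubseteq>\<^bsub>?D1\<^esub> z})"
    by metis
  have g_in: "g z \<in> carrier ?D2"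
    and g_lub: "\<And>u. u \<in> carrier ?D2 \<Longrightarrow>
      g z \<sqsubseteq>\<^bsub>?D2\<^esub> u \<longleftrightarrow> (\<forall>m\<in>base_meets d1. m \<sqsubseteq>\<^bsub>?D1\<^esub> z \<longrightarrow> h m \<sqsubseteq>\<^bsub>?D2\<^esub> u)" for z
  proof -
    have sub: "h ` {m \<in> base_meets d1. m \<sqsubseteq>\<^bsub>?D1\<^esub> z} \<subseteq> carrier ?D2"
      using h_im sub2 by blast
    from g[of z] show "g z \<in> carrier ?D2"
      "\<And>u. u \<in> carrier ?D2 \<Longrightarrow>
      g z \<sqsubseteq>\<^bsub>?D2\<^esub> u \<longleftrightarrow> (\<forall>m\<in>base_meets d1. m \<sqsubseteq>\<^bsub>?D1\<^esub> z \<longrightarrow> h m \<sqsubseteq>\<^bsub>?D2\<^esub> u)"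
      unfolding is_lub_iff[OF po2 sub] by auto
  qed
  \<comment> \<open>Both sides become tests on the base meets below \<open>z\<close>: the left one
    because \<open>g z\<close> is a join, the right one by join-density. \<open>R\<close> matches
    the tests one by one.\<close>
  have g_k: "g z \<sqsubseteq>\<^bsub>?D2\<^esub> k j \<longleftrightarrow> z \<sqsubseteq>\<^bsub>?D1\<^esub> j"
    if "z \<in> carrier ?D1" "j \<in> base_joins d1" for z j
  proof -
    have "k j \<in> carrier ?D2"
      using that k_im sub2 by blast
    then show ?thesis
      using that sub1 by (auto simp: g_lub delta1_join_dense[OF d1, of z j] R)
  qed
  \<comment> \<open>Meet-density in both completions reduces the comparison to base joins, and those
    of \<open>d2\<close> are the \<open>k j\<close>, where \<open>g_k\<close> applies.\<close>
  have g_le: "g z \<sqsubseteq>\<^bsub>?D2\<^esub> g z' \<longleftrightarrow> z \<sqsubseteq>\<^bsub>?D1\<^esub> z'" if "z \<in> carrier ?D1" "z' \<in> carrier ?D1" for z z'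
    unfolding delta1_meet_dense[OF d2 g_in g_in] delta1_meet_dense[OF d1 that(2,1)] k_im[symmetric]
    using that by (auto simp: g_k)
  have g_h: "g m = h m" if m: "m \<in> base_meets d1" for m
  proof (rule delta1_eqI[OF d2 g_in])
    show "h m \<in> carrier ?D2"
      using m h_im sub2 by blast
    fix j assume "j \<in> base_joins d2"
    then show "g m \<sqsubseteq>\<^bsub>?D2\<^esub> j \<longleftrightarrow> h m \<sqsubseteq>\<^bsub>?D2\<^esub> j"
      using m sub1 by (auto simp: g_k R simp flip: k_im)
  qed
  have "w \<in> g ` carrier ?D1" if w: "w \<in> carrier ?D2" for w
  proof -
    have sub: "{m \<in> base_meets d1. h m \<sqsubseteq>\<^bsub>?D2\<^esub> w} \<subseteq> carrier ?D1"
      using sub1 by blast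
    have "complete_lattice ?D1"
      using delta1_imp_completion[OF d1] by (simp add: completion_def)
    \<comment> \<open>The candidate preimage of \<open>w\<close> is the join of all base meets whose
      \<open>h\<close>-image lies below \<open>w\<close>. Then \<open>g z\<close> and
      \<open>w\<close> have the same base joins above them.\<close>
    then obtain z where z: "is_lub ?D1 z {m \<in> base_meets d1. h m \<sqsubseteq>\<^bsub>?D2\<^esub> w}"
      using complete_lattice_lub_exists[OF _ sub] by blast
    then have z_lub: "z \<in> carrier ?D1" "\<And>u. u \<in> carrier ?D1 \<Longrightarrow>
        z \<sqsubseteq>\<^bsub>?D1\<^esub> u \<longleftrightarrow> (\<forall>m\<in>base_meets d1. h m \<sqsubseteq>\<^bsub>?D2\<^esub> w \<longrightarrow> m \<sqsubseteq>\<^bsub>?D1\<^esub> u)"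
      using is_lub_iff[OF po1 sub] by auto
    have "g z = w"
    proof (rule delta1_eqI[OF d2 g_in w])
      fix j assume "j \<in> base_joins d2"
      then obtain i where i: "i \<in> base_joins d1" "j = k i"
        using k_im by blast
      have "w \<sqsubseteq>\<^bsub>?D2\<^esub> k i \<longleftrightarrow> (\<forall>m\<in>base_meets d1. h m \<sqsubseteq>\<^bsub>?D2\<^esub> w \<longrightarrow> h m \<sqsubseteq>\<^bsub>?D2\<^esub> k i)"
        using i k_im sub2 w by (subst delta1_join_dense[OF d2]) (auto simp flip: h_im)
      then show "g z \<sqsubseteq>\<^bsub>?D2\<^esub> j \<longleftrightarrow> w \<sqsubseteq>\<^bsub>?D2\<^esub> j"
        using i z_lub sub1 by (auto simp: g_k R)
    qed
    with z_lub(1) show ?thesis by blast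
  qed
  then have "order_iso ?D1 ?D2 g"
    using g_in g_le by (intro order_isoI po1 po2) blast+
  moreover have "g (ext_map d1 p) = ext_map d2 (hP p)" if p: "p \<in> carrier (ext_dom d1)" for p
  proof -
    have "hX (Inl (ext_map d1 p)) = Inl (ext_map d2 (hP p))"
      using iso p by (simp add: polarity_strict_iso_def)
    then show ?thesis
      using g_h ext_map_in_base(1)[OF emb1 p] by (simp add: h_def)
  qed
  moreover have "order_iso (ext_dom d1) (ext_dom d2) hP"
    using iso by (simp add: polarity_strict_iso_def)
  ultimately show ?thesis
    by (auto simp: extension_iso_via_def)
qed

section \<open>Concept lattices\<close>

text \<open>On a meet-extension this is injective, since \<open>x\<close> is the meet of the images
  above it. Coding points of X in this way keeps the type \<open>'z\<close> out of the completion,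
  so that one carrier type serves all polarities over \<open>'p\<close>.\<close>

definition upset_code :: "('p, 'z) polarity \<Rightarrow> 'z \<Rightarrow> 'p set" where
  "upset_code G x = {p \<in> carrier (pol_P G). x \<sqsubseteq>\<^bsub>pol_X G\<^esub> pol_eX G p}"

text \<open>In the language of formal concepts, the extent belonging to a set \<open>B\<close> of
  attributes, written in codes.\<close>

definition common_lower :: "('p, 'z) polarity \<Rightarrow> 'z set \<Rightarrow> 'p set set" where
  "common_lower G B = upset_code G ` {x \<in> carrier (pol_X G). \<forall>y\<in>B. (x, y) \<in> pol_R G}"

text \<open>
  This is the concept lattice of the relation \<open>R\<close>; its elements are the closed subsets of \<open>X\<close>,
  and each \<open>x\<close> is represented by the set of those \<open>p\<close> whose image lies above it.
\<close>
definition concept_completion :: "('p, 'z) polarity \<Rightarrow> ('p, 'p set set) extension" where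
  "concept_completion G =
     \<lparr>ext_dom = pol_P G,
      ext_cod = \<lparr>carrier = common_lower G ` Pow (carrier (pol_Y G)), eq = (=), le = (\<subseteq>)\<rparr>,
      ext_map = (\<lambda>p. common_lower G {pol_eY G p})\<rparr>"

text \<open>Below, \<open>j\<close> and \<open>m\<close> are the object and attribute concepts of
  \<open>R\<close>. As in every concept lattice, the former are join-dense and the latter
  meet-dense. Coherence ties \<open>R\<close> to the orders at images of P, which makes
  \<open>j\<close> and \<open>m\<close> order embeddings that agree on P; their common value at
  \<open>p\<close> is the image of \<open>p\<close>.\<close>

lemma complete_galois_imp_concept_completion:
  assumes G: "complete_galois_polarity G"
  shows "delta1_completion (concept_completion G)"
    and "\<exists>hX hY. polarity_strict_iso G (generated_polarity (concept_completion G)) hX id hY"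
proof -
  define P X Y eX eY R where defs: "P = pol_P G" "X = pol_X G" "Y = pol_Y G" "eX = pol_eX G"
    "eY = pol_eY G" "R = pol_R G"
  have gal: "galois_polarity G"
    and cX: "completion P X eX" and cY: "completion P Y eY"
    using G unfolding complete_galois_polarity_def defs by blast+
  have ext: "extension_polarity G" and coh: "coherent3 G"
    and meet: "meet_extension P X eX" and join: "join_extension P Y eY"
    using gal unfolding galois_polarity_def defs by blast+
  \<comment> \<open>Positions 4 and 5 of \<open>coh\<close> are (C5) and (C6).\<close>
  note coh = coherent3_C1[OF coh, folded defs] coherent3_C2[OF coh, folded defs]
    coherent3_C3[OF coh, folded defs] coherent3_C5[OF coh, folded defs]
    coherent3_C6[OF coh, folded defs]
  have embX: "order_embedding P X eX" and embY: "order_embedding P Y eY"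
    and clX: "complete_lattice X" and clY: "complete_lattice Y"
    using cX cY unfolding completion_def by blast+
  have poP: "partial_order P" and poX: "partial_order X" and poY: "partial_order Y"
    and eX: "\<And>p. p \<in> carrier P \<Longrightarrow> eX p \<in> carrier X" and eY: "\<And>p. p \<in> carrier P \<Longrightarrow> eY p \<in> carrier Y"
    and eY_le: "\<And>p q. p \<in> carrier P \<Longrightarrow> q \<in> carrier P \<Longrightarrow> eY p \<sqsubseteq>\<^bsub>Y\<^esub> eY q \<longleftrightarrow> p \<sqsubseteq>\<^bsub>P\<^esub> q"
    using embX embY unfolding order_embedding_iff by blast+
  \<comment> \<open>From right to left by (C1) and (C3), from left to right by (C5) at
    \<open>eX p\<close>. With the mirror fact for \<open>eX\<close>, the orders alone decide
    \<open>R\<close> at images of P.\<close>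
  have R_eY: "(x, eY p) \<in> R \<longleftrightarrow> x \<sqsubseteq>\<^bsub>X\<^esub> eX p" if "x \<in> carrier X" "p \<in> carrier P" for x p
    using that coh(1)[of x "eX p" "eY p"] coh(3)[of p] coh(4)[of x "eX p" p] eX eY
      partial_order_le_refl[OF poX] by blast
  have R_eX: "(eX p, y) \<in> R \<longleftrightarrow> eY p \<sqsubseteq>\<^bsub>Y\<^esub> y" if "y \<in> carrier Y" "p \<in> carrier P" for y p
    using that coh(2)[of "eX p" "eY p" y] coh(3)[of p] coh(5)[of "eY p" y p] eX eY
      partial_order_le_refl[OF poY] by blast
  have X_dense: "x \<sqsubseteq>\<^bsub>X\<^esub> x' \<longleftrightarrow> (\<forall>p\<in>carrier P. x' \<sqsubseteq>\<^bsub>X\<^esub> eX p \<longrightarrow> x \<sqsubseteq>\<^bsub>X\<^esub> eX p)"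
    if "x \<in> carrier X" "x' \<in> carrier X" for x x'
  proof -
    have sub: "eX ` {p \<in> carrier P. x' \<sqsubseteq>\<^bsub>X\<^esub> eX p} \<subseteq> carrier X"
      using eX by blast
    have "is_glb X x' (eX ` {p \<in> carrier P. x' \<sqsubseteq>\<^bsub>X\<^esub> eX p})"
      using meet that unfolding meet_extension_def by blast
    then show ?thesis
      unfolding is_glb_iff[OF poX sub] using that by blast
  qed
  have Y_dense: "y \<sqsubseteq>\<^bsub>Y\<^esub> y' \<longleftrightarrow> (\<forall>p\<in>carrier P. eY p \<sqsubseteq>\<^bsub>Y\<^esub> y \<longrightarrow> eY p \<sqsubseteq>\<^bsub>Y\<^esub> y')"
    if "y \<in> carrier Y" "y' \<in> carrier Y" for y y'
  proof -
    have sub: "eY ` {p \<in> carrier P. eY p \<sqsubseteq>\<^bsub>Y\<^esub> y} \<subseteq> carrier Y"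
      using eY by blast
    have "is_lub Y y (eY ` {p \<in> carrier P. eY p \<sqsubseteq>\<^bsub>Y\<^esub> y})"
      using join that unfolding join_extension_def by blast
    then show ?thesis
      unfolding is_lub_iff[OF poY sub] using that by blast
  qed
  define c where "c = upset_code G"
  have c: "c x = {p \<in> carrier P. x \<sqsubseteq>\<^bsub>X\<^esub> eX p}" for x
    by (simp add: c_def upset_code_def defs)
  have mem_c: "p \<in> c x \<longleftrightarrow> p \<in> carrier P \<and> x \<sqsubseteq>\<^bsub>X\<^esub> eX p" for p x
    by (simp add: c)
  have c_inj: "x = x'" if "x \<in> carrier X" "x' \<in> carrier X" "c x = c x'" for x x'
    using that X_dense[of x x'] X_dense[of x' x] partial_order_le_antisym[OF poX, of x x']
    unfolding c by blast
  define U where "U = common_lower G"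
  have U: "U B = c ` {x \<in> carrier X. \<forall>y\<in>B. (x, y) \<in> R}" for B
    by (simp add: U_def common_lower_def c_def defs)
  have c_U: "c x \<in> U B \<longleftrightarrow> (\<forall>y\<in>B. (x, y) \<in> R)" if "x \<in> carrier X" for x B
    unfolding U using c_inj that by blast
  have U_sub: "U B \<subseteq> Z \<longleftrightarrow> (\<forall>x\<in>carrier X. c x \<in> U B \<longrightarrow> c x \<in> Z)" for B Z
    unfolding U using c_inj by blast
  define d where "d = concept_completion G"
  have d_sel: "ext_dom d = P" "\<And>p. ext_map d p = U {eY p}"
    by (simp_all add: d_def concept_completion_def U_def defs)
  define D where "D = ext_cod d"
  have D: "carrier D = U ` Pow (carrier Y)" "eq D = (=)" "le D = (\<subseteq>)"
    by (simp_all add: D_def d_def concept_completion_def U_def defs)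
  have poD: "partial_order D"
    by (rule partial_orderI) (auto simp: D)
  have U_in: "U B \<in> carrier D" if "B \<subseteq> carrier Y" for B
    using that by (auto simp: D)
  \<comment> \<open>\<open>j x\<close> codes the principal down-set of \<open>x\<close> (see
    \<open>c_j\<close>). Presenting it by the attributes \<open>eY p\<close> with \<open>p\<close>
    above \<open>x\<close> makes it visibly an element of \<open>D\<close>.\<close>
  define j where "j x = U (eY ` c x)" for x
  define m where "m y = U {y}" for y
  have j_in: "j x \<in> carrier D" for x
    unfolding j_def c by (rule U_in) (use eY in auto)
  have m_in: "m y \<in> carrier D" if "y \<in> carrier Y" for y
    unfolding m_def by (rule U_in) (use that in auto)
  have c_j: "c x' \<in> j x \<longleftrightarrow> x' \<sqsubseteq>\<^bsub>X\<^esub> x" if "x \<in> carrier X" "x' \<in> carrier X" for x x'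
    using that by (auto simp: j_def c_U X_dense[of x' x] R_eY mem_c)
  have c_m: "c x \<in> m y \<longleftrightarrow> (x, y) \<in> R" if "x \<in> carrier X" for x y
    using that by (auto simp: m_def c_U)
  have c_self: "c x \<in> j x" if "x \<in> carrier X" for x
    using that partial_order_le_refl[OF poX] by (simp add: c_j)
  \<comment> \<open>\<open>j x\<close> is the least closed set containing the code of
    \<open>x\<close>, because (C1) makes every closed set downward closed.\<close>
  have j_sub: "j x \<subseteq> Z \<longleftrightarrow> c x \<in> Z" if x: "x \<in> carrier X" and Z: "Z \<in> carrier D" for x Z
  proof -
    obtain B where B: "B \<subseteq> carrier Y" "Z = U B"
      using Z by (auto simp: D)
    have "c x' \<in> U B" if "x' \<in> carrier X" "x' \<sqsubseteq>\<^bsub>X\<^esub> x" "c x \<in> U B" for x'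
      using that x B(1) coh(1)[of x' x] by (auto simp: c_U)
    then have "c x \<in> U B \<Longrightarrow> j x \<subseteq> U B"
      using U_sub[of "eY ` c x" "U B"] c_j[OF x] by (auto simp: j_def)
    then show ?thesis
      using c_self[OF x] B(2) by blast
  qed
  have j_le: "j x \<subseteq> j x' \<longleftrightarrow> x \<sqsubseteq>\<^bsub>X\<^esub> x'" if "x \<in> carrier X" "x' \<in> carrier X" for x x'
    using that by (simp add: j_sub[OF _ j_in] c_j)
  have j_m: "j x \<subseteq> m y \<longleftrightarrow> (x, y) \<in> R" if "x \<in> carrier X" "y \<in> carrier Y" for x y
    using that by (simp add: j_sub m_in c_m)
  \<comment> \<open>At images of P, object and attribute concepts coincide; this is why one map into
    \<open>D\<close> can play the roles of both \<open>eX\<close> and \<open>eY\<close>.\<close>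
  have e_j: "U {eY p} = j (eX p)" if "p \<in> carrier P" for p
  proof -
    have "U {eY p} \<subseteq> j (eX p)"
      unfolding U_sub using that eX by (auto simp: c_U c_j R_eY)
    moreover have "j (eX p) \<subseteq> U {eY p}"
      using that eX eY U_in coh(3) by (subst j_sub) (auto simp: c_U)
    ultimately show ?thesis
      by blast
  qed
  have e_m: "U {eY p} = m (eY p)" for p
    by (simp add: m_def)
  have m_le: "m y \<subseteq> m y' \<longleftrightarrow> y \<sqsubseteq>\<^bsub>Y\<^esub> y'" if y: "y \<in> carrier Y" "y' \<in> carrier Y" for y y'
  proof
    assume "m y \<subseteq> m y'"
    then have "(x, y) \<in> R \<Longrightarrow> (x, y') \<in> R" if "x \<in> carrier X" for x
      using c_m that by blast
    \<comment> \<open>Test the inclusion at \<open>x = eX p\<close>: there \<open>R_eX\<close> turns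
      \<open>R\<close> into the order of Y, and the join-extension property finishes.\<close>
    then show "y \<sqsubseteq>\<^bsub>Y\<^esub> y'"
      unfolding Y_dense[OF y] using eX y R_eX by blast
  next
    assume "y \<sqsubseteq>\<^bsub>Y\<^esub> y'"
    then have "c x \<in> m y \<Longrightarrow> c x \<in> m y'" if "x \<in> carrier X" for x
      using that y coh(2) by (auto simp: c_m)
    then show "m y \<subseteq> m y'"
      using U_sub[of "{y}" "m y'"] by (auto simp: m_def)
  qed
  have emb: "order_embedding P D (\<lambda>p. U {eY p})"
    unfolding order_embedding_iff
    using poP poD m_in eY by (auto simp: D(3) m_le eY_le simp flip: m_def)
  have "\<exists>A. is_glb D A \<A>" if \<A>: "\<A> \<subseteq> carrier D" for \<A>
  proof -
    \<comment> \<open>\<open>U\<close> turns unions into intersections, so the union of all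
      presentations of members of \<open>\<A>\<close> presents their meet. Taking all presentations
      avoids a choice, and an empty \<open>\<A>\<close> gives the top element.\<close>
    define B where "B = \<Union> {B. B \<subseteq> carrier Y \<and> U B \<in> \<A>}"
    have "C \<subseteq> U B \<longleftrightarrow> (\<forall>A\<in>\<A>. C \<subseteq> A)" if C: "C \<in> carrier D" for C
    proof -
      obtain B' where B': "C = U B'"
        using C by (auto simp: D)
      have "c x \<in> U B \<longleftrightarrow> (\<forall>A\<in>\<A>. c x \<in> A)" if "x \<in> carrier X" for x
      proof -
        have "c x \<in> U B \<longleftrightarrow> (\<forall>B. B \<subseteq> carrier Y \<and> U B \<in> \<A> \<longrightarrow> c x \<in> U B)"
          unfolding c_U[OF that] B_def by blast
        also have "\<dots> \<longleftrightarrow> (\<forall>A\<in>\<A>. c x \<in> A)"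
          using \<A> unfolding D by blast
        finally show ?thesis .
      qed
      then show ?thesis
        unfolding B' U_sub by blast
    qed
    moreover have "U B \<in> carrier D"
      by (rule U_in) (auto simp: B_def)
    ultimately have "is_glb D (U B) \<A>"
      unfolding is_glb_iff[OF poD \<A>] D(3) by blast
    then show ?thesis ..
  qed
  then have clD: "complete_lattice D"
    by (rule complete_lattice_if_glbs[OF poD])
  have meets: "base_meets d = j ` carrier X"
  proof (rule Set.set_eqI)
    fix Z
    \<comment> \<open>\<open>j\<close> preserves meets of images of P: membership of a code
      \<open>c x'\<close> unfolds on both sides to \<open>x'\<close> lying below all
      \<open>eX p\<close> with \<open>p\<close> in \<open>S\<close>.\<close>
    have glb: "is_glb D (j x) ((\<lambda>p. U {eY p}) ` S)" if S: "S \<subseteq> carrier P" and x: "is_glb X x (eX ` S)" for S x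
    proof -
      have subX: "eX ` S \<subseteq> carrier X" and subD: "(\<lambda>p. U {eY p}) ` S \<subseteq> carrier D"
        using S eX eY U_in by auto
      have x': "x \<in> carrier X" "\<And>l. l \<in> carrier X \<Longrightarrow> l \<sqsubseteq>\<^bsub>X\<^esub> x \<longleftrightarrow> (\<forall>p\<in>S. l \<sqsubseteq>\<^bsub>X\<^esub> eX p)"
        using x unfolding is_glb_iff[OF poX subX] by auto
      have "C \<subseteq> j x \<longleftrightarrow> (\<forall>p\<in>S. C \<subseteq> U {eY p})" if C: "C \<in> carrier D" for C
      proof -
        obtain B where B: "C = U B"
          using C by (auto simp: D)
        have "c x' \<in> j x \<longleftrightarrow> (\<forall>p\<in>S. c x' \<in> U {eY p})" if "x' \<in> carrier X" for x'
          using that x' S by (auto simp: c_j c_U R_eY subset_iff)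
        then show ?thesis
          unfolding B U_sub by blast
      qed
      then show ?thesis
        unfolding is_glb_iff[OF poD subD] D(3) using j_in by auto
    qed
    show "Z \<in> base_meets d \<longleftrightarrow> Z \<in> j ` carrier X"
    proof
      assume "Z \<in> base_meets d"
      then obtain S where S: "S \<subseteq> carrier P" "is_glb D Z ((\<lambda>p. U {eY p}) ` S)"
        by (auto simp: base_meets_def D_def d_sel)
      have "eX ` S \<subseteq> carrier X"
        using S(1) eX by auto
      \<comment> \<open>Completeness of X enters here: an arbitrary \<open>S\<close> has a meet
        \<open>x\<close> in X, and uniqueness of meets in \<open>D\<close> forces
        \<open>Z = j x\<close>.\<close>
      then obtain x where x: "is_glb X x (eX ` S)"
        using complete_lattice_glb_exists[OF clX] by blast
      have "Z = j x"
        using partial_order.greatest_unique[OF poD S(2) glb[OF S(1) x]] .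
      moreover have "x \<in> carrier X"
        using x by (auto simp: greatest_def Lower_def)
      ultimately show "Z \<in> j ` carrier X"
        by blast
    next
      assume "Z \<in> j ` carrier X"
      then obtain x where x: "x \<in> carrier X" "Z = j x"
        by blast
      have "is_glb X x (eX ` {p \<in> carrier P. x \<sqsubseteq>\<^bsub>X\<^esub> eX p})"
        using meet x unfolding meet_extension_def by blast
      from glb[OF _ this] have "is_glb D Z ((\<lambda>p. U {eY p}) ` {p \<in> carrier P. x \<sqsubseteq>\<^bsub>X\<^esub> eX p})"
        using x by auto
      then show "Z \<in> base_meets d"
        unfolding base_meets_def d_sel mem_Collect_eq D_def
        by (intro exI[of _ "{p \<in> carrier P. x \<sqsubseteq>\<^bsub>X\<^esub> eX p}"]) auto
    qed
  qed
  have m_dense: "C \<subseteq> C' \<longleftrightarrow> (\<forall>y\<in>carrier Y. C' \<subseteq> m y \<longrightarrow> C \<subseteq> m y)"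
    if CC': "C \<in> carrier D" "C' \<in> carrier D" for C C'
  proof -
    obtain B where B: "B \<subseteq> carrier Y" "C' = U B"
      using CC' by (auto simp: D)
    obtain B' where B': "C = U B'"
      using CC' by (auto simp: D)
    \<comment> \<open>The attributes in a presentation \<open>B\<close> of \<open>C'\<close> are
      themselves test points, and they already cut out \<open>C'\<close>.\<close>
    have above: "C' \<subseteq> m y" if "y \<in> B" for y
      unfolding B U_sub using that B by (auto simp: c_U c_m)
    have "C \<subseteq> C'" if below: "\<And>y. y \<in> carrier Y \<Longrightarrow> C' \<subseteq> m y \<Longrightarrow> C \<subseteq> m y"
    proof -
      have "(x, y) \<in> R" if "x \<in> carrier X" "c x \<in> C" "y \<in> B" for x y
        using that above[OF that(3)] below[of y] B(1) c_m[of x y] by blast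
      then show ?thesis
        unfolding B' B(2) U_sub by (auto simp: c_U)
    qed
    then show ?thesis
      by blast
  qed
  have joins: "base_joins d = m ` carrier Y"
  proof (rule Set.set_eqI)
    fix Z
    have lub: "is_lub D (m y) ((\<lambda>p. U {eY p}) ` T)" if T: "T \<subseteq> carrier P" and y: "is_lub Y y (eY ` T)" for T y
    proof -
      have subY: "eY ` T \<subseteq> carrier Y" and subD: "(\<lambda>p. U {eY p}) ` T \<subseteq> carrier D"
        using T eY U_in by auto
      then have TY: "eY p \<in> carrier Y" if "p \<in> T" for p
        using that by blast
      have y': "y \<in> carrier Y" "\<And>u. u \<in> carrier Y \<Longrightarrow> y \<sqsubseteq>\<^bsub>Y\<^esub> u \<longleftrightarrow> (\<forall>p\<in>T. eY p \<sqsubseteq>\<^bsub>Y\<^esub> u)"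
        using y unfolding is_lub_iff[OF poY subY] by auto
      \<comment> \<open>Joins in \<open>D\<close> need not be unions, so there is no elementwise
        test as for meets. By \<open>m_dense\<close> it suffices to take \<open>C = m u\<close>, and
        there \<open>m_le\<close> reduces the claim to the join in Y.\<close>
      have "m y \<subseteq> C \<longleftrightarrow> (\<forall>p\<in>T. m (eY p) \<subseteq> C)" if C: "C \<in> carrier D" for C
      proof -
        have "m y \<subseteq> m u \<longleftrightarrow> (\<forall>p\<in>T. m (eY p) \<subseteq> m u)" if "u \<in> carrier Y" for u
          using that y' TY by (simp add: m_le)
        moreover have "m (eY p) \<in> carrier D" if "p \<in> T" for p
          using that TY m_in by blast
        ultimately show ?thesis
          using m_dense[OF _ C] m_in[OF y'(1)] by blast
      qed
      then show ?thesis
        unfolding is_lub_iff[OF poD subD] D(3) using m_in[OF y'(1)] by (auto simp: e_m)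
    qed
    show "Z \<in> base_joins d \<longleftrightarrow> Z \<in> m ` carrier Y"
    proof
      assume "Z \<in> base_joins d"
      then obtain T where T: "T \<subseteq> carrier P" "is_lub D Z ((\<lambda>p. U {eY p}) ` T)"
        by (auto simp: base_joins_def D_def d_sel)
      have "eY ` T \<subseteq> carrier Y"
        using T(1) eY by auto
      then obtain y where y: "is_lub Y y (eY ` T)"
        using complete_lattice_lub_exists[OF clY] by blast
      have "Z = m y"
        using partial_order.least_unique[OF poD T(2) lub[OF T(1) y]] .
      moreover have "y \<in> carrier Y"
        using y by (auto simp: least_def Upper_def)
      ultimately show "Z \<in> m ` carrier Y"
        by blast
    next
      assume "Z \<in> m ` carrier Y"
      then obtain y where y: "y \<in> carrier Y" "Z = m y"
        by blast
      have "is_lub Y y (eY ` {p \<in> carrier P. eY p \<sqsubseteq>\<^bsub>Y\<^esub> y})"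
        using join y unfolding join_extension_def by blast
      from lub[OF _ this] have "is_lub D Z ((\<lambda>p. U {eY p}) ` {p \<in> carrier P. eY p \<sqsubseteq>\<^bsub>Y\<^esub> y})"
        using y by auto
      then show "Z \<in> base_joins d"
        unfolding base_joins_def d_sel mem_Collect_eq D_def
        by (intro exI[of _ "{p \<in> carrier P. eY p \<sqsubseteq>\<^bsub>Y\<^esub> y}"]) auto
    qed
  qed
  have "\<exists>M\<subseteq>base_meets d. is_lub D Z M" if Z: "Z \<in> carrier D" for Z
  proof -
    define M where "M = {j x | x. x \<in> carrier X \<and> j x \<subseteq> Z}"
    have MD: "M \<subseteq> carrier D"
      using j_in by (auto simp: M_def)
    obtain B where B: "Z = U B"
      using Z by (auto simp: D)
    \<comment> \<open>A code \<open>c x\<close> in \<open>Z\<close> puts \<open>j x\<close> below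
      \<open>Z\<close> by \<open>j_sub\<close>, hence below \<open>C\<close>; and \<open>j x\<close>
      contains \<open>c x\<close>.\<close>
    have "Z \<subseteq> C" if "C \<in> carrier D" "\<forall>A\<in>M. A \<subseteq> C" for C
      unfolding B U_sub using that(2) j_sub[OF _ Z] c_self B unfolding M_def by blast
    moreover have "\<forall>A\<in>M. A \<subseteq> Z"
      by (auto simp: M_def)
    ultimately have "is_lub D Z M"
      unfolding is_lub_iff[OF poD MD] D(3) using Z by blast
    moreover have "M \<subseteq> base_meets d"
      by (auto simp: M_def meets)
    ultimately show ?thesis by blast
  qed
  moreover have "\<exists>J\<subseteq>base_joins d. is_glb D Z J" if Z: "Z \<in> carrier D" for Z
  proof -
    define J where "J = {m y | y. y \<in> carrier Y \<and> Z \<subseteq> m y}"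
    have JD: "J \<subseteq> carrier D"
      using m_in by (auto simp: J_def)
    have "C \<subseteq> Z" if "C \<in> carrier D" "\<forall>A\<in>J. C \<subseteq> A" for C
      unfolding m_dense[OF that(1) Z] using that(2) unfolding J_def by blast
    moreover have "\<forall>A\<in>J. Z \<subseteq> A"
      by (auto simp: J_def)
    ultimately have "is_glb D Z J"
      unfolding is_glb_iff[OF poD JD] D(3) using Z by blast
    moreover have "J \<subseteq> base_joins d"
      by (auto simp: J_def joins)
    ultimately show ?thesis by blast
  qed
  moreover have "ext_map d = (\<lambda>p. U {eY p})"
    using d_sel by auto
  ultimately have delta1: "delta1_completion d"
    using emb clD unfolding delta1_completion_def completion_def d_sel D_def by simp
  then show "delta1_completion (concept_completion G)"
    by (simp add: d_def)
  have po: "partial_order (pol_X (generated_polarity d))" "partial_order (pol_Y (generated_polarity d))"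
    using generated_polarity_complete_galois[OF delta1]
    unfolding complete_galois_polarity_def completion_def order_embedding_def by blast+
  have "order_iso X (pol_X (generated_polarity d)) (\<lambda>x. Inl (j x))"
    by (rule order_isoI[OF poX po(1)]) (auto simp: meets j_le D(3) simp flip: D_def)
  moreover have "order_iso Y (pol_Y (generated_polarity d)) (\<lambda>y. Inr (m y))"
    by (rule order_isoI[OF poY po(2)]) (auto simp: joins m_le D(3) simp flip: D_def)
  ultimately have "polarity_strict_iso G (generated_polarity d) (\<lambda>x. Inl (j x)) id (\<lambda>y. Inr (m y))"
    unfolding polarity_strict_iso_def defs[symmetric]
    using order_iso_id[OF poP] by (auto simp: d_sel e_m e_j[unfolded e_m, symmetric] j_m meets joins D(3) simp flip: D_def)
  then show "\<exists>hX hY. polarity_strict_iso G (generated_polarity (concept_completion G)) hX id hY"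
    unfolding d_def by blast
qed

section \<open>Isomorphism classes\<close>

text \<open>As \<open>R\<close> is exactly the pullback of \<open>S\<close> along \<open>f\<close>,
  well-definedness and injectivity on classes are the two directions of one equivalence;
  surjectivity up to \<open>S\<close> gives the rest.\<close>

lemma quotient_bij_betw:
  assumes B: "equiv B S" and f: "f \<in> A \<rightarrow> B"
    and R: "R = {(a, a'). a \<in> A \<and> a' \<in> A \<and> (f a, f a') \<in> S}"
    and onto: "\<And>b. b \<in> B \<Longrightarrow> \<exists>a\<in>A. (f a, b) \<in> S"
  shows "\<exists>F. bij_betw F (A // R) (B // S) \<and> (\<forall>a\<in>A. F (R `` {a}) = S `` {f a})"
proof -
  \<comment> \<open>All classes in this union coincide, so no representative has to be
    chosen.\<close>
  define F where "F C = (\<Union>a\<in>C. S `` {f a})" for C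
  have S_refl: "(b, b) \<in> S" if "b \<in> B" for b
    using B that by (auto simp: equiv_def refl_on_def)
  have F: "F (R `` {a}) = S `` {f a}" if "a \<in> A" for a
  proof -
    have "(f a, f a) \<in> S"
      using that f S_refl by blast
    then have "a \<in> R `` {a}"
      using that by (simp add: R)
    moreover have "S `` {f a'} = S `` {f a}" if "a' \<in> R `` {a}" for a'
      using equiv_class_eq[OF B, of "f a" "f a'"] that by (simp add: R)
    ultimately show ?thesis
      unfolding F_def by blast
  qed
  have "inj_on F (A // R)"
  proof (rule inj_onI)
    fix C C' assume "C \<in> A // R" "C' \<in> A // R" and eq: "F C = F C'"
    then obtain a a' where a: "a \<in> A" "C = R `` {a}" "a' \<in> A" "C' = R `` {a'}"
      by (auto elim!: quotientE)
    then have "S `` {f a} = S `` {f a'}"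
      using eq F by simp
    then have "\<And>b. (f a, b) \<in> S \<longleftrightarrow> (f a', b) \<in> S"
      by blast
    then show "C = C'"
      using a by (auto simp: R)
  qed
  moreover have "F ` (A // R) = B // S"
  proof
    show "F ` (A // R) \<subseteq> B // S"
      using f F by (auto elim!: quotientE intro!: quotientI)
    show "B // S \<subseteq> F ` (A // R)"
    proof
      fix C assume "C \<in> B // S"
      then obtain b where b: "b \<in> B" "C = S `` {b}"
        by (rule quotientE)
      then obtain a where a: "a \<in> A" "(f a, b) \<in> S"
        using onto by blast
      then have "C = F (R `` {a})"
        using equiv_class_eq[OF B a(2)] b F by simp
      then show "C \<in> F ` (A // R)"
        using a(1) by (auto intro: quotientI)
    qed
  qed
  ultimately have "bij_betw F (A // R) (B // S)"
    by (simp add: bij_betw_def)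
  with F show ?thesis by blast
qed

section \<open>The isomorphism relations on complete Galois polarities are equivalences\<close>

lemma complete_galois_imp_galois: "complete_galois_polarity G \<Longrightarrow> galois_polarity G"
  unfolding complete_galois_polarity_def by (rule conjunct1)

lemma complete_galois_imp_ext: "complete_galois_polarity G \<Longrightarrow> extension_polarity G"
  by (drule complete_galois_imp_galois) (simp add: galois_polarity_def)

lemma polarity_iso_iff:
  "complete_galois_polarity G \<Longrightarrow>
    polarity_iso G G' \<longleftrightarrow> (\<exists>hX hP hY. polarity_strict_iso G G' hX hP hY)"
  unfolding polarity_iso_def using polarity_iso_via_iff[OF complete_galois_imp_galois] by blast

lemma polarity_iso_over_iff:
  "complete_galois_polarity G \<Longrightarrow> polarity_iso_over P G G' \<longleftrightarrow>
    pol_P G = P \<and> pol_P G' = P \<and> (\<exists>hX hY. polarity_strict_iso G G' hX id hY)"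
  unfolding polarity_iso_over_def using polarity_iso_via_iff[OF complete_galois_imp_galois] by blast

lemma strict_iso_sym:
  assumes "extension_polarity G" "polarity_strict_iso G G' hX hP hY"
  shows "\<exists>gX gP gY. polarity_strict_iso G' G gX gP gY"
proof -
  have "inj_on hP (carrier (pol_P G))"
    using assms(2) by (simp add: polarity_strict_iso_def order_iso_def bij_betw_def)
  then show ?thesis
    using strict_iso_inverse[OF assms, of "inv_into (carrier (pol_P G)) hP"] by auto
qed

lemma equiv_polarity_iso_rel:
  "equiv {G. complete_galois_polarity G} polarity_iso_rel"
proof (rule equivI)
  show "polarity_iso_rel \<subseteq> {G. complete_galois_polarity G} \<times> {G. complete_galois_polarity G}"
    by (auto simp: polarity_iso_rel_def)
  show "refl_on {G. complete_galois_polarity G} polarity_iso_rel"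
    using polarity_iso_iff strict_iso_id[OF complete_galois_imp_ext]
    by (fastforce simp: refl_on_def polarity_iso_rel_def)
  show "sym polarity_iso_rel"
    using strict_iso_sym[OF complete_galois_imp_ext]
    by (intro symI) (fastforce simp: polarity_iso_rel_def polarity_iso_iff)
  show "trans polarity_iso_rel"
    using strict_iso_compose[OF complete_galois_imp_ext]
    by (intro transI) (fastforce simp: polarity_iso_rel_def polarity_iso_iff)
qed

lemma equiv_polarity_iso_rel_over:
  "equiv {G. complete_galois_polarity G \<and> pol_P G = P} (polarity_iso_rel_over P)"
proof (rule equivI)
  show "polarity_iso_rel_over P \<subseteq> {G. complete_galois_polarity G \<and> pol_P G = P} \<times>
      {G. complete_galois_polarity G \<and> pol_P G = P}"
    by (auto simp: polarity_iso_rel_over_def polarity_iso_over_def)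
  show "refl_on {G. complete_galois_polarity G \<and> pol_P G = P} (polarity_iso_rel_over P)"
    using polarity_iso_over_iff strict_iso_id[OF complete_galois_imp_ext]
    by (fastforce simp: refl_on_def polarity_iso_rel_over_def)
  show "sym (polarity_iso_rel_over P)"
    using strict_iso_inverse[OF complete_galois_imp_ext, of _ _ _ id _ id]
    by (intro symI) (fastforce simp: polarity_iso_rel_over_def polarity_iso_over_iff)
  show "trans (polarity_iso_rel_over P)"
  proof (rule transI)
    fix G1 G2 G3 assume "(G1, G2) \<in> polarity_iso_rel_over P" "(G2, G3) \<in> polarity_iso_rel_over P"
    then show "(G1, G3) \<in> polarity_iso_rel_over P"
      using strict_iso_compose[OF complete_galois_imp_ext, of G1 G2 _ id _ G3 _ id]
      by (fastforce simp: polarity_iso_rel_over_def polarity_iso_over_iff)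
  qed
qed

lemma extension_iso_iff_polarity_iso:
  assumes "delta1_completion d1" "delta1_completion d2"
  shows "extension_iso d1 d2 \<longleftrightarrow> polarity_iso (generated_polarity d1) (generated_polarity d2)"
  unfolding extension_iso_def polarity_iso_iff[OF generated_polarity_complete_galois[OF assms(1)]]
  using extension_iso_imp_strict_iso[OF assms] strict_iso_imp_extension_iso[OF assms] by blast

text \<open>Both translations of isomorphisms leave the map on P as it is, so they specialise to
  \<open>id\<close>.\<close>

lemma extension_iso_over_iff_polarity_iso_over:
  assumes "delta1_completion d1" "delta1_completion d2"
  shows "extension_iso_over P d1 d2 \<longleftrightarrow>
    polarity_iso_over P (generated_polarity d1) (generated_polarity d2)"
  unfolding extension_iso_over_def
    polarity_iso_over_iff[OF generated_polarity_complete_galois[OF assms(1)]] generated_polarity_sel(1)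
  using extension_iso_imp_strict_iso[OF assms] strict_iso_imp_extension_iso[OF assms] by blast

lemma concept_completion_iso_over:
  assumes G: "complete_galois_polarity G"
  shows "polarity_iso_over (pol_P G) (generated_polarity (concept_completion G)) G"
proof -
  note delta1 = complete_galois_imp_concept_completion(1)[OF G]
  obtain hX hY where "polarity_strict_iso G (generated_polarity (concept_completion G)) hX id hY"
    using complete_galois_imp_concept_completion(2)[OF G] by blast
  from strict_iso_inverse[OF complete_galois_imp_ext[OF G] this, of id]
  obtain gX gY where "polarity_strict_iso (generated_polarity (concept_completion G)) G gX id gY"
    by auto
  moreover have "ext_dom (concept_completion G) = pol_P G"
    by (simp add: concept_completion_def)
  ultimately show ?thesis
    unfolding polarity_iso_over_iff[OF generated_polarity_complete_galois[OF delta1]] by auto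
qed

lemma polarity_iso_over_imp_iso: "polarity_iso_over P G G' \<Longrightarrow> polarity_iso G G'"
  by (auto simp: polarity_iso_over_def polarity_iso_def)

section \<open>The induced bijections on isomorphism classes\<close>

lemma delta1_classes_bij:
  "\<exists>F. bij_betw F
      ({d :: ('p, 'p set set) extension. delta1_completion d} // delta1_iso_rel)
      ({G :: ('p, 'p set set + 'p set set) polarity. complete_galois_polarity G} // polarity_iso_rel) \<and>
    (\<forall>d. delta1_completion d \<longrightarrow>
      F (delta1_iso_rel `` {d}) = polarity_iso_rel `` {generated_polarity d})"
proof -
  have onto: "\<exists>a\<in>{d. delta1_completion d}. (generated_polarity a, G) \<in> polarity_iso_rel"
    if "G \<in> {G. complete_galois_polarity G}" for G :: "('p, 'p set set + 'p set set) polarity"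
    using that complete_galois_imp_concept_completion(1)[of G]
      polarity_iso_over_imp_iso[OF concept_completion_iso_over[of G]]
    by (intro bexI[of _ "concept_completion G"])
      (simp_all add: polarity_iso_rel_def generated_polarity_complete_galois)
  have R: "(delta1_iso_rel :: (('p, 'p set set) extension \<times> _) set) =
      {(a, a'). a \<in> {d. delta1_completion d} \<and> a' \<in> {d. delta1_completion d} \<and>
        (generated_polarity a, generated_polarity a') \<in> polarity_iso_rel}"
    by (auto simp: delta1_iso_rel_def polarity_iso_rel_def extension_iso_iff_polarity_iso
        generated_polarity_complete_galois)
  have f: "generated_polarity \<in> {d. delta1_completion d} \<rightarrow> {G. complete_galois_polarity G}"
    by (simp add: generated_polarity_complete_galois)
  show ?thesis
    using quotient_bij_betw[OF equiv_polarity_iso_rel f R onto] by auto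
qed

lemma delta1_classes_over_bij:
  "\<exists>F. bij_betw F
      ({d :: ('p, 'p set set) extension. delta1_completion d \<and> ext_dom d = P}
        // delta1_iso_rel_over P)
      ({G :: ('p, 'p set set + 'p set set) polarity. complete_galois_polarity G \<and> pol_P G = P}
        // polarity_iso_rel_over P) \<and>
    (\<forall>d. delta1_completion d \<and> ext_dom d = P \<longrightarrow>
      F (delta1_iso_rel_over P `` {d}) = polarity_iso_rel_over P `` {generated_polarity d})"
proof -
  let ?A = "{d :: ('p, 'p set set) extension. delta1_completion d \<and> ext_dom d = P}"
  have onto: "\<exists>a\<in>?A. (generated_polarity a, G) \<in> polarity_iso_rel_over P"
    if "G \<in> {G. complete_galois_polarity G \<and> pol_P G = P}"
    for G :: "('p, 'p set set + 'p set set) polarity"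
    using that complete_galois_imp_concept_completion(1)[of G] concept_completion_iso_over[of G]
    by (intro bexI[of _ "concept_completion G"])
      (auto simp: polarity_iso_rel_over_def generated_polarity_complete_galois
        polarity_iso_over_def)
  have R: "delta1_iso_rel_over P =
      {(a, a'). a \<in> ?A \<and> a' \<in> ?A \<and>
        (generated_polarity a, generated_polarity a') \<in> polarity_iso_rel_over P}"
    using extension_iso_over_iff_polarity_iso_over[of _ _ P] generated_polarity_complete_galois
    unfolding delta1_iso_rel_over_def polarity_iso_rel_over_def extension_iso_over_def by blast
  have f: "generated_polarity \<in> ?A \<rightarrow> {G. complete_galois_polarity G \<and> pol_P G = P}"
    by (simp add: generated_polarity_complete_galois)
  show ?thesis
    using quotient_bij_betw[OF equiv_polarity_iso_rel_over f R onto] by auto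
qed

text \<open>A set of classes requires a fixed carrier type. The clauses before each bijection state
  the correspondence for arbitrary carrier types, so the result does not depend on the choice of
  \<open>'p set set\<close>.\<close>

theorem theorem7p26:
  shows
    "(\<forall>d :: ('p, 'd) extension. delta1_completion d \<longrightarrow>
        complete_galois_polarity (generated_polarity d)) \<and>
     (\<forall>(d1 :: ('p, 'd) extension) (d2 :: ('q, 'e) extension).
        delta1_completion d1 \<and> delta1_completion d2 \<longrightarrow>
        (extension_iso d1 d2 \<longleftrightarrow>
         polarity_iso (generated_polarity d1) (generated_polarity d2))) \<and>
     (\<forall>G :: ('p, 'z) polarity. complete_galois_polarity G \<longrightarrow>
        (\<exists>d :: ('p, 'p set set) extension. delta1_completion d \<and>
           polarity_iso (generated_polarity d) G)) \<and>
     (\<exists>F. bij_betw F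
            ({d :: ('p, 'p set set) extension. delta1_completion d} // delta1_iso_rel)
            ({G :: ('p, 'p set set + 'p set set) polarity. complete_galois_polarity G}
               // polarity_iso_rel) \<and>
          (\<forall>d. delta1_completion d \<longrightarrow>
             F (delta1_iso_rel `` {d}) = polarity_iso_rel `` {generated_polarity d})) \<and>
     (\<forall>P :: 'p gorder. partial_order P \<longrightarrow>
       (\<forall>d :: ('p, 'd) extension. delta1_completion d \<and> ext_dom d = P \<longrightarrow>
          complete_galois_polarity (generated_polarity d) \<and> pol_P (generated_polarity d) = P) \<and>
       (\<forall>(d1 :: ('p, 'd) extension) (d2 :: ('p, 'e) extension).
          delta1_completion d1 \<and> ext_dom d1 = P \<and> delta1_completion d2 \<and> ext_dom d2 = P \<longrightarrow>
          (extension_iso_over P d1 d2 \<longleftrightarrow>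
           polarity_iso_over P (generated_polarity d1) (generated_polarity d2))) \<and>
       (\<forall>G :: ('p, 'z) polarity. complete_galois_polarity G \<and> pol_P G = P \<longrightarrow>
          (\<exists>d :: ('p, 'p set set) extension. delta1_completion d \<and> ext_dom d = P \<and>
             polarity_iso_over P (generated_polarity d) G)) \<and>
       (\<exists>F. bij_betw F
              ({d :: ('p, 'p set set) extension. delta1_completion d \<and> ext_dom d = P}
                 // delta1_iso_rel_over P)
              ({G :: ('p, 'p set set + 'p set set) polarity.
                  complete_galois_polarity G \<and> pol_P G = P} // polarity_iso_rel_over P) \<and>
            (\<forall>d. delta1_completion d \<and> ext_dom d = P \<longrightarrow>
               F (delta1_iso_rel_over P `` {d}) =
                 polarity_iso_rel_over P `` {generated_polarity d})))"
proof (intro conjI allI impI)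
  fix G :: "('p, 'z) polarity" assume G: "complete_galois_polarity G"
  show "\<exists>d :: ('p, 'p set set) extension. delta1_completion d \<and> polarity_iso (generated_polarity d) G"
    using complete_galois_imp_concept_completion(1)[OF G]
      polarity_iso_over_imp_iso[OF concept_completion_iso_over[OF G]] by blast
next
  fix P :: "'p gorder" and G :: "('p, 'z) polarity"
  assume G: "complete_galois_polarity G \<and> pol_P G = P"
  then have "polarity_iso_over P (generated_polarity (concept_completion G)) G"
    using concept_completion_iso_over by blast
  moreover from this have "ext_dom (concept_completion G) = P"
    by (simp add: polarity_iso_over_def)
  ultimately show "\<exists>d :: ('p, 'p set set) extension. delta1_completion d \<and> ext_dom d = P \<and>
      polarity_iso_over P (generated_polarity d) G"
    using complete_galois_imp_concept_completion(1) G by blast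
qed (use generated_polarity_complete_galois extension_iso_iff_polarity_iso
    extension_iso_over_iff_polarity_iso_over in
  \<open>blast intro: delta1_classes_bij delta1_classes_over_bij generated_polarity_sel(1) | simp\<close>)+

end
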